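(* Let $n\ge 1$, and let $\mathcal{T}'$ and $\mathcal{T}$ be torsion classes in $\operatorname{tors} RA_n$. Suppose that $\mathcal{T}'=\mathscr{F}ilt(\mathcal{T}\cup\{M\})$, where $M$ is a minimal extending module for $\mathcal{T}$. Then $$\operatorname{inv}(\mathcal{T}')\setminus\operatorname{inv}(\mathcal{T})=\{\operatorname{inv}(M)\}.$$ In particular, the lattice $\operatorname{tors} RA_n$ is isomorphic to the weak order on $A_n$.
   Context: Let $k$ be a field. $Q$ is the quiver with vertex set $[n]=\{1,\dots,n\}$ and arrows $a_i:i\to i+1$, $a_i^*:i+1\to i$ for $1\le i\le n-1$; $I$ is the two-sided ideal of $kQ$ generated by all two-cycles $a_ia_i^*$, $a_i^*a_i$; and $RA_n=kQ/I$. Modules are finite-dimensional and identified with representations of $(Q,I)$. The support of a representation $M$ is the set of vertices $i$ with $M(i)\ne0$; for an indecomposable $RA_n$-module it is an interval $[p,r]=\{p,p+1,\dots,r\}$. A torsion class is a class of modules closed under factors, isomorphisms and extensions; $\operatorname{tors} RA_n$ is the lattice of torsion classes ordered by containment. $\mathscr{F}ilt(\mathcal{S})$ is the class of modules $N$ with a finite chain of submodules $N=N_l\supsetneq\dots\supsetneq N_0=0$ ($l\ge0$) such that each $N_i/N_{i-1}$ is isomorphic to an indecomposable module in $\mathcal{S}$. $M$ is a minimal extending module for $\mathcal{T}$ if: (P1) every proper factor of $M$ is in $\mathcal{T}$; (P2) if $0\to M\to X\to T\to0$ is a non-split exact sequence with $T\in\mathcal{T}$, then $X\in\mathcal{T}$;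 (P3) $\operatorname{Hom}(\mathcal{T},M)=0$. Such an $M$ is indecomposable. For an indecomposable $RA_n$-module $M$ with support $[p,r]$, $\operatorname{inv}(M)$ is the pair $(p-1,r)$. For a torsion class $\mathcal{T}$, $\operatorname{inv}(\mathcal{T})=\{\operatorname{inv}(M): M\in\mathcal{T}\text{ indecomposable}\}$. $A_n$ denotes the symmetric group on $\{0,1,\dots,n\}$. Write a permutation in one-line notation $w=w_0\cdots w_n$; an inversion of $w$ is a pair of values $w_i>w_j$ with $i<j$. The weak order on $A_n$ orders permutations by containment of inversion sets; it is a lattice. *)

theory Defs
  imports
    Complex_Main
    "HOL-Library.Function_Algebras"
    "HOL-Combinatorics.Permutations"
    "HOL-Algebra.Lattice"
begin

text \<open>
  The ground field is a type \<open>'k\<close> of class \<open>field\<close>.  To have one fixed universe of modules,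
  the spaces of a representation are finite-dimensional subspaces of the vector space of all
  sequences over \<open>'k\<close>.  Every finite-dimensional space is isomorphic to such a subspace, and
  all classes of modules considered below are closed under isomorphism.
\<close>

definition fscale :: "'k::field \<Rightarrow> (nat \<Rightarrow> 'k) \<Rightarrow> (nat \<Rightarrow> 'k)" where
  "fscale c v = (\<lambda>j. c * v j)"

global_interpretation fvec: vector_space "fscale :: 'k::field \<Rightarrow> (nat \<Rightarrow> 'k) \<Rightarrow> (nat \<Rightarrow> 'k)"
  by unfold_locales (auto simp: fscale_def fun_eq_iff algebra_simps)

definition fd_subspace :: "(nat \<Rightarrow> 'k::field) set \<Rightarrow> bool" where
  "fd_subspace V \<longleftrightarrow> (\<exists>B. finite B \<and> V = fvec.span B)"

definition lin_map :: "(nat \<Rightarrow> 'k::field) set \<Rightarrow> (nat \<Rightarrow> 'k) set \<Rightarrow> ((nat \<Rightarrow> 'k) \<Rightarrow> (nat \<Rightarrow> 'k)) \<Rightarrow> bool"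
  where
  "lin_map V W f \<longleftrightarrow> f ` V \<subseteq> W \<and> (\<forall>x\<in>V. \<forall>y\<in>V. f (x + y) = f x + f y)
     \<and> (\<forall>c. \<forall>x\<in>V. f (fscale c x) = fscale c (f x))"

section \<open>Representations of the double quiver modulo two-cycles\<close>

text \<open>
  \<open>up M i\<close> is the action of \<open>a\<^sub>i : i \<rightarrow> i + 1\<close>, and \<open>dn M i\<close> that of \<open>a\<^sub>i\<^sup>* : i + 1 \<rightarrow> i\<close>.
  Only the vertices \<open>1..n\<close>, the arrows with index in \<open>{1..<n}\<close> and the values of maps on
  their domain matter; anything else in the record is ignored everywhere.
\<close>

record 'k rep =
  spc :: "nat \<Rightarrow> (nat \<Rightarrow> 'k) set"
  up :: "nat \<Rightarrow> (nat \<Rightarrow> 'k) \<Rightarrow> (nat \<Rightarrow> 'k)"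
  dn :: "nat \<Rightarrow> (nat \<Rightarrow> 'k) \<Rightarrow> (nat \<Rightarrow> 'k)"

definition is_rep :: "nat \<Rightarrow> 'k::field rep \<Rightarrow> bool" where
  "is_rep n M \<longleftrightarrow>
     (\<forall>i\<in>{1..n}. fd_subspace (spc M i)) \<and>
     (\<forall>i\<in>{1..<n}. lin_map (spc M i) (spc M (i + 1)) (up M i)
                \<and> lin_map (spc M (i + 1)) (spc M i) (dn M i)
                \<and> (\<forall>x\<in>spc M i. dn M i (up M i x) = 0)
                \<and> (\<forall>x\<in>spc M (i + 1). up M i (dn M i x) = 0))"

definition support :: "nat \<Rightarrow> 'k::field rep \<Rightarrow> nat set" where
  "support n M = {i \<in> {1..n}. spc M i \<noteq> {0}}"

definition is_zero :: "nat \<Rightarrow> 'k::field rep \<Rightarrow> bool" where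
  "is_zero n M \<longleftrightarrow> support n M = {}"

definition is_hom :: "nat \<Rightarrow> 'k::field rep \<Rightarrow> 'k rep \<Rightarrow> (nat \<Rightarrow> (nat \<Rightarrow> 'k) \<Rightarrow> (nat \<Rightarrow> 'k)) \<Rightarrow> bool" where
  "is_hom n M N f \<longleftrightarrow>
     (\<forall>i\<in>{1..n}. lin_map (spc M i) (spc N i) (f i)) \<and>
     (\<forall>i\<in>{1..<n}. (\<forall>x\<in>spc M i. f (i + 1) (up M i x) = up N i (f i x))
                \<and> (\<forall>x\<in>spc M (i + 1). f i (dn M i x) = dn N i (f (i + 1) x)))"

definition is_mono :: "nat \<Rightarrow> 'k::field rep \<Rightarrow> 'k rep \<Rightarrow> (nat \<Rightarrow> (nat \<Rightarrow> 'k) \<Rightarrow> (nat \<Rightarrow> 'k)) \<Rightarrow> bool" where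
  "is_mono n M N f \<longleftrightarrow> is_hom n M N f \<and> (\<forall>i\<in>{1..n}. inj_on (f i) (spc M i))"

definition is_epi :: "nat \<Rightarrow> 'k::field rep \<Rightarrow> 'k rep \<Rightarrow> (nat \<Rightarrow> (nat \<Rightarrow> 'k) \<Rightarrow> (nat \<Rightarrow> 'k)) \<Rightarrow> bool" where
  "is_epi n M N f \<longleftrightarrow> is_hom n M N f \<and> (\<forall>i\<in>{1..n}. f i ` spc M i = spc N i)"

definition isomorphic :: "nat \<Rightarrow> 'k::field rep \<Rightarrow> 'k rep \<Rightarrow> bool" where
  "isomorphic n M N \<longleftrightarrow> (\<exists>f. is_mono n M N f \<and> is_epi n M N f)"

text \<open>A family of subspaces of \<open>M\<close>, stable under the arrows, forms a submodule; \<open>restr M U\<close> is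
  this submodule as a representation in its own right.\<close>

definition is_sub :: "nat \<Rightarrow> (nat \<Rightarrow> (nat \<Rightarrow> 'k::field) set) \<Rightarrow> 'k rep \<Rightarrow> bool" where
  "is_sub n U M \<longleftrightarrow>
     (\<forall>i\<in>{1..n}. fvec.subspace (U i) \<and> U i \<subseteq> spc M i) \<and>
     (\<forall>i\<in>{1..<n}. up M i ` U i \<subseteq> U (i + 1) \<and> dn M i ` U (i + 1) \<subseteq> U i)"

definition restr :: "'k::field rep \<Rightarrow> (nat \<Rightarrow> (nat \<Rightarrow> 'k) set) \<Rightarrow> 'k rep" where
  "restr M U = M\<lparr>spc := U\<rparr>"

text \<open>\<open>quot_iso n M U X\<close> says \<open>M / U \<cong> X\<close>, i.e.\ some epimorphism from \<open>M\<close> onto \<open>X\<close> has kernel \<open>U\<close>.\<close>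

definition quot_iso :: "nat \<Rightarrow> 'k::field rep \<Rightarrow> (nat \<Rightarrow> (nat \<Rightarrow> 'k) set) \<Rightarrow> 'k rep \<Rightarrow> bool" where
  "quot_iso n M U X \<longleftrightarrow>
     (\<exists>f. is_epi n M X f \<and> (\<forall>i\<in>{1..n}. {x \<in> spc M i. f i x = 0} = U i))"

definition short_exact :: "nat \<Rightarrow> 'k::field rep \<Rightarrow> 'k rep \<Rightarrow> 'k rep \<Rightarrow>
    (nat \<Rightarrow> (nat \<Rightarrow> 'k) \<Rightarrow> (nat \<Rightarrow> 'k)) \<Rightarrow> (nat \<Rightarrow> (nat \<Rightarrow> 'k) \<Rightarrow> (nat \<Rightarrow> 'k)) \<Rightarrow> bool" where
  "short_exact n A B C f g \<longleftrightarrow> is_mono n A B f \<and> is_epi n B C g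
     \<and> (\<forall>i\<in>{1..n}. f i ` spc A i = {x \<in> spc B i. g i x = 0})"

text \<open>For a short exact sequence ending in the epimorphism \<open>g\<close> from \<open>B\<close> to \<open>C\<close>.\<close>

definition splits :: "nat \<Rightarrow> 'k::field rep \<Rightarrow> 'k rep \<Rightarrow> (nat \<Rightarrow> (nat \<Rightarrow> 'k) \<Rightarrow> (nat \<Rightarrow> 'k)) \<Rightarrow> bool" where
  "splits n B C g \<longleftrightarrow> (\<exists>s. is_hom n C B s \<and> (\<forall>i\<in>{1..n}. \<forall>x\<in>spc C i. g i (s i x) = x))"

definition indecomposable :: "nat \<Rightarrow> 'k::field rep \<Rightarrow> bool" where
  "indecomposable n M \<longleftrightarrow> is_rep n M \<and> \<not> is_zero n M \<and>
     \<not> (\<exists>U W. is_sub n U M \<and> is_sub n W M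
          \<and> \<not> is_zero n (restr M U) \<and> \<not> is_zero n (restr M W)
          \<and> (\<forall>i\<in>{1..n}. U i \<inter> W i = {0} \<and> spc M i = {x + y | x y. x \<in> U i \<and> y \<in> W i}))"

section \<open>Torsion classes\<close>

text \<open>A torsion class is nonempty, that is, it contains the zero modules.\<close>

definition torsion_class :: "nat \<Rightarrow> 'k::field rep set \<Rightarrow> bool" where
  "torsion_class n T \<longleftrightarrow>
     T \<noteq> {} \<and> (\<forall>M\<in>T. is_rep n M) \<and>
     (\<forall>M\<in>T. \<forall>U N. is_sub n U M \<and> is_rep n N \<and> quot_iso n M U N \<longrightarrow> N \<in> T) \<and>
     (\<forall>M\<in>T. \<forall>N. is_rep n N \<and> isomorphic n M N \<longrightarrow> N \<in> T) \<and>
     (\<forall>A\<in>T. \<forall>C\<in>T. \<forall>B f g. is_rep n B \<and> short_exact n A B C f g \<longrightarrow> B \<in> T)"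

definition tors :: "nat \<Rightarrow> 'k::field rep set gorder" where
  "tors n = \<lparr>carrier = {T. torsion_class n T}, eq = (=), le = (\<subseteq>)\<rparr>"

text \<open>\<open>U 0, \<dots>, U l\<close> is the chain of submodules of \<open>N\<close>.\<close>

definition Filt :: "nat \<Rightarrow> 'k::field rep set \<Rightarrow> 'k rep set" where
  "Filt n S = {N. is_rep n N \<and> (\<exists>l U.
     (\<forall>j\<le>l. is_sub n (U j) N) \<and>
     (\<forall>i\<in>{1..n}. U 0 i = {0} \<and> U l i = spc N i) \<and>
     (\<forall>j<l. (\<forall>i\<in>{1..n}. U j i \<subseteq> U (Suc j) i) \<and> (\<exists>i\<in>{1..n}. U j i \<noteq> U (Suc j) i)) \<and>
     (\<forall>j<l. \<exists>X\<in>S. indecomposable n X \<and> quot_iso n (restr N (U (Suc j))) (U j) X))}"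

text \<open>A minimal extending module is required to be nonzero: the zero module trivially satisfies the
  other three conditions for every torsion class, but is not meant, as minimal extending modules
  are to be indecomposable.\<close>

definition minimal_extending :: "nat \<Rightarrow> 'k::field rep set \<Rightarrow> 'k rep \<Rightarrow> bool" where
  "minimal_extending n T M \<longleftrightarrow> is_rep n M \<and> \<not> is_zero n M \<and>
     (\<forall>U N. is_sub n U M \<and> \<not> is_zero n (restr M U) \<and> is_rep n N \<and> quot_iso n M U N \<longrightarrow> N \<in> T) \<and>
     (\<forall>X f g. \<forall>C\<in>T. is_rep n X \<and> short_exact n M X C f g \<and> \<not> splits n X C g \<longrightarrow> X \<in> T) \<and>
     (\<forall>C\<in>T. \<forall>f. is_hom n C M f \<longrightarrow> (\<forall>i\<in>{1..n}. \<forall>x\<in>spc C i. f i x = 0))"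

text \<open>The support of an indecomposable representation is an interval \<open>[p, r]\<close> with \<open>p \<ge> 1\<close>.\<close>

definition inv_mod :: "nat \<Rightarrow> 'k::field rep \<Rightarrow> nat \<times> nat" where
  "inv_mod n M = (Min (support n M) - 1, Max (support n M))"

definition inv_tors :: "nat \<Rightarrow> 'k::field rep set \<Rightarrow> (nat \<times> nat) set" where
  "inv_tors n T = {inv_mod n M | M. M \<in> T \<and> indecomposable n M}"

section \<open>The weak order\<close>

text \<open>The one-line notation of \<open>w\<close> is \<open>w 0, \<dots>, w n\<close>; an inversion is recorded as a pair of values,
  smaller value first.\<close>

definition inversions :: "nat \<Rightarrow> (nat \<Rightarrow> nat) \<Rightarrow> (nat \<times> nat) set" where
  "inversions n w = {(w j, w i) | i j. i < j \<and> j \<le> n \<and> w i > w j}"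

definition weak_order :: "nat \<Rightarrow> (nat \<Rightarrow> nat) gorder" where
  "weak_order n = \<lparr>carrier = {w. w permutes {0..n}}, eq = (=),
     le = (\<lambda>v w. inversions n v \<subseteq> inversions n w)\<rparr>"

text \<open>\<^const>\<open>join_pres\<close> and \<^const>\<open>meet_pres\<close> include that both arguments are lattices.\<close>

definition lattice_isomorphic :: "'a gorder \<Rightarrow> 'b gorder \<Rightarrow> bool" where
  "lattice_isomorphic L L' \<longleftrightarrow>
     (\<exists>\<phi>. bij_betw \<phi> (carrier L) (carrier L') \<and> join_pres L L' \<phi> \<and> meet_pres L L' \<phi>)"

end

(* Every nonzero representation has a string module as a direct summand.  To see this, filter the
   spaces from left to right: a filtration F of M(i) gives the filtration of M(i+1) whose lower
   half consists of the images of F under a_i and whose upper half consists of the preimages of F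
   under a_i^*.  A vector and a functional that pair to 1 on a layer at the last vertex of the
   support extend leftwards along a string, which gives a section and a retraction.

   A string module on the interval (i, j] has as string quotients its restrictions to those
   subintervals at whose ends the arrows point outwards, and any two string modules with the same
   support have a nonzero homomorphism between them.  Hence a torsion class T is determined by
   inv(T), namely M is in T iff all string quotients of M have their inversion in inv(T).  Glueing
   strings and cutting them at an edge shows that the sets inv(T) are exactly the biclosed sets of
   pairs, that is, the inversion sets of permutations.

   If M is a minimal extending module for T, then (P1) and (P2), applied to glued strings, show
   that inv(T) together with inv(M) is biclosed.  The torsion class of this set contains T and M,
   hence also Filt(T + M), while (P3) excludes inv(M) from inv(T). *)

theory Submission
  imports Defs
begin

section \<open>Linear algebra\<close>

text \<open>Modules are never decomposed completely; splitting off one string at a time suffices.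
  This is why vectors and functionals travel in pairs. A vector alone yields only a map from a
  string and a functional alone only a map to one; together they yield a summand, and the complement
  of a summand is again a quotient of the module, so it inherits every condition on quotients.

  The obstacle to describing a torsion class by intervals is that an interval carries many
  non-isomorphic strings. It is overcome by comparing two orientations of one interval: they share a
  block that is a quotient of the one string and a submodule of the other. This block gives the
  nonzero homomorphism, and it also lets one string in the torsion class stand in for another with
  the same support.

  A minimal extending module is a string for a similar reason: a string summand smaller than
  \<open>M\<close> would be a proper factor, in the torsion class by (P1), and its inclusion into
  \<open>M\<close> would contradict (P3).\<close>

definition lin_fun :: "(nat \<Rightarrow> 'k::field) set \<Rightarrow> ((nat \<Rightarrow> 'k) \<Rightarrow> 'k) \<Rightarrow> bool" where
  "lin_fun V \<phi> \<longleftrightarrow> (\<forall>x\<in>V. \<forall>y\<in>V. \<phi> (x + y) = \<phi> x + \<phi> y) \<and> (\<forall>c. \<forall>x\<in>V. \<phi> (fscale c x) = c * \<phi> x)"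

lemma separating_functional:
  assumes "fvec.subspace F" "x \<notin> F"
  obtains \<phi> :: "(nat \<Rightarrow> 'k::field) \<Rightarrow> 'k" where "lin_fun UNIV \<phi>" "\<And>v. v \<in> F \<Longrightarrow> \<phi> v = 0" "\<phi> x = 1"
proof -
  interpret P: vector_space_pair "fscale :: 'k \<Rightarrow> (nat \<Rightarrow> 'k) \<Rightarrow> (nat \<Rightarrow> 'k)" "(*) :: 'k \<Rightarrow> 'k \<Rightarrow> 'k"
    by unfold_locales (auto simp: algebra_simps)
  obtain B where B: "B \<subseteq> F" "fvec.independent B" "F \<subseteq> fvec.span B"
    using fvec.maximal_independent_subset by blast
  have FB: "fvec.span B = F"
    using B assms(1) fvec.span_minimal by blast
  then have "x \<notin> fvec.span B"
    using assms(2) by simp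
  then have "fvec.independent (insert x B)"
    using B(2) fvec.independent_insertI by blast
  from P.linear_independent_extend[OF this, of "\<lambda>v. if v = x then 1 else 0"]
  obtain g where g: "Vector_Spaces.linear fscale (*) g" "\<forall>v\<in>insert x B. g v = (if v = x then 1 else 0)"
    by blast
  interpret g: Vector_Spaces.linear fscale "(*)" g by (rule g(1))
  have "x \<notin> B" using \<open>x \<notin> fvec.span B\<close> fvec.span_base by blast
  then have 0: "g v = 0" if "v \<in> B" for v using g(2) that by auto
  have "g v = 0" if "v \<in> F" for v
    using P.linear_eq_0_on_span[OF g(1), of B v] 0 that FB by auto
  moreover have "lin_fun UNIV g"
    by (auto simp: lin_fun_def g.add g.scale)
  ultimately show ?thesis using that g(2) by auto
qed

lemma lin_fun_subset: "lin_fun V \<phi> \<Longrightarrow> U \<subseteq> V \<Longrightarrow> lin_fun U \<phi>"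
  unfolding lin_fun_def by blast

lemma lin_map_subspaces:
  assumes "lin_map V W f" "fvec.subspace V"
  shows "f 0 = 0"
    and "fvec.subspace U \<Longrightarrow> U \<subseteq> V \<Longrightarrow> fvec.subspace (f ` U)"
    and "fvec.subspace U \<Longrightarrow> fvec.subspace {x\<in>V. f x \<in> U}"
proof -
  have add: "f (x + y) = f x + f y" if "x \<in> V" "y \<in> V" for x y
    using assms(1) that unfolding lin_map_def by blast
  have scale: "f (fscale c x) = fscale c (f x)" if "x \<in> V" for x c
    using assms(1) that unfolding lin_map_def by blast
  have "f (fscale 0 0) = fscale 0 (f 0)"
    using assms(2) fvec.subspace_0 scale by blast
  then show zero: "f 0 = 0" by simp
  show "fvec.subspace (f ` U)" if U: "fvec.subspace U" "U \<subseteq> V"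
  proof (rule fvec.subspaceI)
    show "0 \<in> f ` U" using zero fvec.subspace_0[OF U(1)] by force
  next
    fix x y assume "x \<in> f ` U" "y \<in> f ` U"
    then obtain a b where "a \<in> U" "x = f a" "b \<in> U" "y = f b" by blast
    then show "x + y \<in> f ` U"
      using add[of a b] fvec.subspace_add[OF U(1), of a b] U(2) by (metis image_eqI subsetD)
  next
    fix c x assume "x \<in> f ` U"
    then obtain a where "a \<in> U" "x = f a" by blast
    then show "fscale c x \<in> f ` U"
      using scale[of a c] fvec.subspace_scale[OF U(1), of a c] U(2) by (metis image_eqI subsetD)
  qed
  show "fvec.subspace {x\<in>V. f x \<in> U}" if U: "fvec.subspace U"
    using U assms(2) zero
    by (auto simp: fvec.subspace_def add scale)
qed

lemma lin_map_diff:
  assumes "lin_map V W f" "fvec.subspace V" "x \<in> V" "y \<in> V"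
  shows "f (x - y) = f x - f y"
proof -
  have "x - y \<in> V" using assms fvec.subspace_diff by blast
  then have "f ((x - y) + y) = f (x - y) + f y"
    using assms unfolding lin_map_def by blast
  then show ?thesis by simp
qed

lemma lin_fun_diff:
  assumes "lin_fun V f" "fvec.subspace V" "x \<in> V" "y \<in> V"
  shows "f (x - y) = f x - f y"
proof -
  have "x - y \<in> V" using assms fvec.subspace_diff by blast
  then have "f ((x - y) + y) = f (x - y) + f y"
    using assms unfolding lin_fun_def by blast
  then show ?thesis by simp
qed

text \<open>Every \<open>v\<close> in \<open>V\<close> is \<phi> v times \<open>z\<close> plus an
  element of the kernel \<open>K\<close> of \<phi>, so it is enough that \<psi> kills
  \<open>F\<close> and the image of \<open>K\<close> and takes the value 1 at \<open>f z\<close>.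
  The hypothesis \<open>vanish\<close> makes this consistent. The lemma carries a functional from
  the source of an arrow to its target.\<close>

lemma factor_functional:
  assumes f: "lin_map V W f" and V: "fvec.subspace V"
    and F: "fvec.subspace F" and \<phi>: "lin_fun V \<phi>" and z: "z \<in> V" "\<phi> z = 1"
    and vanish: "\<And>v. v \<in> V \<Longrightarrow> f v \<in> F \<Longrightarrow> \<phi> v = 0"
  obtains \<psi> where "lin_fun UNIV \<psi>" "\<And>v. v \<in> F \<Longrightarrow> \<psi> v = 0" "\<And>v. v \<in> V \<Longrightarrow> \<psi> (f v) = \<phi> v"
proof -
  define K where "K = {v\<in>V. \<phi> v = 0}"
  have \<phi>0: "\<phi> 0 = 0"
    using lin_fun_diff[OF \<phi> V z(1) z(1)] by simp
  have K: "fvec.subspace K"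
    using V \<phi> \<phi>0 unfolding K_def lin_fun_def fvec.subspace_def by auto
  have fK: "fvec.subspace (f ` K)"
    by (rule lin_map_subspaces(2)[OF f V K]) (auto simp: K_def)
  define G where "G = {x + y | x y. x \<in> f ` K \<and> y \<in> F}"
  have G: "fvec.subspace G"
    unfolding G_def by (rule fvec.subspace_sums[OF fK F])
  have "f z \<notin> G"
  proof
    assume "f z \<in> G"
    then obtain y w where y: "y \<in> K" "w \<in> F" "f z = f y + w" unfolding G_def by blast
    then have "f (z - y) \<in> F"
      using lin_map_diff[OF f V z(1), of y] by (auto simp: K_def)
    moreover have "z - y \<in> V" using y z V fvec.subspace_diff K_def by blast
    ultimately have "\<phi> (z - y) = 0" using vanish by blast
    then show False using lin_fun_diff[OF \<phi> V z(1), of y] y(1) z(2) by (simp add: K_def)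
  qed
  then obtain \<psi> where \<psi>: "lin_fun UNIV \<psi>" "\<And>v. v \<in> G \<Longrightarrow> \<psi> v = 0" "\<psi> (f z) = 1"
    using separating_functional[OF G] by blast
  have "0 \<in> f ` K" "0 \<in> F" using fK F fvec.subspace_0 by blast+
  then have "x \<in> G" if "x \<in> f ` K \<or> x \<in> F" for x
    using that unfolding G_def by (metis (mono_tags, lifting) add_0 add.right_neutral mem_Collect_eq)
  then have sub: "f ` K \<subseteq> G" "F \<subseteq> G" by blast+
  have "\<psi> (f v) = \<phi> v" if v: "v \<in> V" for v
  proof -
    define y where "y = v - fscale (\<phi> v) z"
    have sz: "fscale (\<phi> v) z \<in> V" using V z fvec.subspace_scale by blast
    have yV: "y \<in> V" using V v sz fvec.subspace_diff unfolding y_def by blast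
    have "\<phi> y = \<phi> v - \<phi> (fscale (\<phi> v) z)"
      unfolding y_def by (rule lin_fun_diff[OF \<phi> V v sz])
    also have "\<phi> (fscale (\<phi> v) z) = \<phi> v" using \<phi> z unfolding lin_fun_def by simp
    finally have "y \<in> K" using yV by (simp add: K_def)
    then have 0: "\<psi> (f y) = 0" using sub \<psi>(2) by blast
    have "f v = f (y + fscale (\<phi> v) z)" by (simp add: y_def)
    also have "\<dots> = f y + fscale (\<phi> v) (f z)"
      using f yV sz z unfolding lin_map_def by auto
    finally show ?thesis
      using \<psi>(1,3) 0 unfolding lin_fun_def by simp
  qed
  then show ?thesis using that \<psi>(1,2) sub(2) by blast
qed

section \<open>Subspaces of finite-dimensional spaces\<close>

lemma fd_subspace_subspace: "fd_subspace V \<Longrightarrow> fvec.subspace V"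
  unfolding fd_subspace_def by (metis fvec.subspace_span)

text \<open>The ambient sequence space has infinite dimension, so bases are shown to be finite by
  comparison with a finite spanning set. For strictness, a basis of \<open>U\<close> is enlarged by
  a vector outside \<open>U\<close>.\<close>

lemma fd_subspace_subset:
  assumes "fd_subspace V" "fvec.subspace U" "U \<subseteq> V"
  shows "fd_subspace U" "fvec.dim U \<le> fvec.dim V" "U \<noteq> V \<Longrightarrow> fvec.dim U < fvec.dim V"
proof -
  obtain C where C: "finite C" "V = fvec.span C" using assms(1) fd_subspace_def by blast
  obtain B where B: "B \<subseteq> U" "fvec.independent B" "U \<subseteq> fvec.span B" "card B = fvec.dim U"
    using fvec.basis_exists by blast
  have UB: "U = fvec.span B" using B assms(2) fvec.span_minimal by blast
  have finB: "finite B"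
    using fvec.independent_span_bound[OF C(1) B(2)] B(1) assms(3) C(2) by blast
  then show "fd_subspace U" using UB fd_subspace_def by blast
  obtain D where D: "D \<subseteq> V" "fvec.independent D" "V \<subseteq> fvec.span D" "card D = fvec.dim V"
    using fvec.basis_exists by blast
  have finD: "finite D"
    using fvec.independent_span_bound[OF C(1) D(2)] D(1) C(2) by blast
  show "fvec.dim U \<le> fvec.dim V"
    using fvec.independent_span_bound[OF finD B(2)] B(1,4) D(3,4) assms(3) by auto
  show "fvec.dim U < fvec.dim V" if ne: "U \<noteq> V"
  proof -
    obtain x where x: "x \<in> V" "x \<notin> U" using ne assms(3) by blast
    then have ind: "fvec.independent (insert x B)"
      using UB B(2) fvec.independent_insertI by blast
    have "insert x B \<subseteq> fvec.span D" using x B(1) assms(3) D(3) by blast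
    from fvec.independent_span_bound[OF finD ind this] have "card (insert x B) \<le> fvec.dim V"
      using D(4) by simp
    moreover have "x \<notin> B" using x(2) B(1) by blast
    ultimately show ?thesis using finB B(4) by simp
  qed
qed

section \<open>Homomorphisms and submodules\<close>

lemma is_rep_subspace: "is_rep n M \<Longrightarrow> k \<in> {1..n} \<Longrightarrow> fvec.subspace (spc M k)"
  unfolding is_rep_def using fd_subspace_subspace by blast

lemma is_rep_arrows:
  assumes "is_rep n M" "1 \<le> k" "k < n"
  shows "lin_map (spc M k) (spc M (k + 1)) (up M k)" "lin_map (spc M (k + 1)) (spc M k) (dn M k)"
    "x \<in> spc M k \<Longrightarrow> dn M k (up M k x) = 0" "y \<in> spc M (k + 1) \<Longrightarrow> up M k (dn M k y) = 0"
  using assms unfolding is_rep_def by auto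

lemma lin_map_in: "lin_map V W f \<Longrightarrow> x \<in> V \<Longrightarrow> f x \<in> W"
  unfolding lin_map_def by blast

lemma is_hom_lin: "is_hom n M N f \<Longrightarrow> k \<in> {1..n} \<Longrightarrow> lin_map (spc M k) (spc N k) (f k)"
  unfolding is_hom_def by blast

lemma is_hom_in: "is_hom n M N f \<Longrightarrow> k \<in> {1..n} \<Longrightarrow> x \<in> spc M k \<Longrightarrow> f k x \<in> spc N k"
  using is_hom_lin lin_map_in by blast

lemma is_hom_zero: "is_rep n M \<Longrightarrow> is_hom n M N f \<Longrightarrow> k \<in> {1..n} \<Longrightarrow> f k 0 = 0"
  using lin_map_subspaces(1) is_hom_lin is_rep_subspace by blast

lemma is_hom_comp:
  assumes "is_hom n M N f" "is_hom n N X g"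
  shows "is_hom n M X (\<lambda>k x. g k (f k x))"
proof -
  have 1: "lin_map (spc M k) (spc X k) (\<lambda>x. g k (f k x))" if "k \<in> {1..n}" for k
    using is_hom_lin[OF assms(1) that] is_hom_lin[OF assms(2) that]
    unfolding lin_map_def by (auto simp: image_subset_iff)
  have "g (k + 1) (f (k + 1) (up M k x)) = up X k (g k (f k x))" if "k \<in> {1..<n}" "x \<in> spc M k" for k x
    using that assms is_hom_in[OF assms(1), of k x] unfolding is_hom_def by auto
  moreover have "g k (f k (dn M k x)) = dn X k (g (k + 1) (f (k + 1) x))"
    if "k \<in> {1..<n}" "x \<in> spc M (k + 1)" for k x
    using that assms is_hom_in[OF assms(1), of "k + 1" x] unfolding is_hom_def by auto
  ultimately show ?thesis using 1 unfolding is_hom_def by blast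
qed

lemma is_epi_comp:
  assumes "is_epi n M N f" "is_epi n N X g"
  shows "is_epi n M X (\<lambda>k x. g k (f k x))"
proof -
  have "(\<lambda>x. g k (f k x)) ` spc M k = spc X k" if "k \<in> {1..n}" for k
    using assms that unfolding is_epi_def by (metis image_image)
  moreover have "is_hom n M X (\<lambda>k x. g k (f k x))"
    using assms unfolding is_epi_def by (elim conjE) (rule is_hom_comp)
  ultimately show ?thesis
    unfolding is_epi_def by blast
qed

lemma is_hom_id: "is_hom n M M (\<lambda>k x. x)"
  by (auto simp: is_hom_def lin_map_def)

lemma inj_on_hom:
  assumes "is_rep n M" "is_hom n M N f" "k \<in> {1..n}" "\<And>x. x \<in> spc M k \<Longrightarrow> f k x = 0 \<Longrightarrow> x = 0"
  shows "inj_on (f k) (spc M k)"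
proof (rule inj_onI)
  fix x y assume xy: "x \<in> spc M k" "y \<in> spc M k" "f k x = f k y"
  have V: "fvec.subspace (spc M k)" using is_rep_subspace assms by blast
  have "f k (x - y) = 0"
    using lin_map_diff[OF is_hom_lin[OF assms(2,3)] V xy(1,2)] xy by simp
  then have "x - y = 0" using assms(4) fvec.subspace_diff[OF V xy(1,2)] by blast
  then show "x = y" by simp
qed

section \<open>Kernels, images and submodules as representations\<close>

definition kern :: "'k::field rep \<Rightarrow> (nat \<Rightarrow> (nat \<Rightarrow> 'k) \<Rightarrow> (nat \<Rightarrow> 'k)) \<Rightarrow> nat \<Rightarrow> (nat \<Rightarrow> 'k) set" where
  "kern M f k = {x \<in> spc M k. f k x = 0}"

lemma is_sub_kern:
  assumes M: "is_rep n M" and N: "is_rep n N" and f: "is_hom n M N f"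
  shows "is_sub n (kern M f) M"
proof -
  have "fvec.subspace (kern M f k)" if "k \<in> {1..n}" for k
    using lin_map_subspaces(3)[OF is_hom_lin[OF f that] is_rep_subspace[OF M that],
        of "{0}"] fvec.subspace_single_0 by (simp add: kern_def)
  moreover have "up M k x \<in> kern M f (k + 1)" if "k \<in> {1..<n}" "x \<in> kern M f k" for k x
    using that f is_hom_zero[OF M f] M N lin_map_subspaces(1)[OF is_rep_arrows(1)[OF N, of k] is_rep_subspace[OF N, of k]]
      lin_map_in[OF is_rep_arrows(1)[OF M, of k], of x]
    unfolding kern_def is_hom_def by auto
  moreover have "dn M k x \<in> kern M f k" if "k \<in> {1..<n}" "x \<in> kern M f (k + 1)" for k x
    using that f is_hom_zero[OF M f] M N lin_map_subspaces(1)[OF is_rep_arrows(2)[OF N, of k] is_rep_subspace[OF N, of "k + 1"]]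
      lin_map_in[OF is_rep_arrows(2)[OF M, of k], of x]
    unfolding kern_def is_hom_def by auto
  ultimately show ?thesis
    by (auto simp: is_sub_def kern_def)
qed

lemma is_subD:
  assumes "is_sub n U M"
  shows "k \<in> {1..n} \<Longrightarrow> fvec.subspace (U k)" "k \<in> {1..n} \<Longrightarrow> U k \<subseteq> spc M k"
    "k \<in> {1..<n} \<Longrightarrow> x \<in> U k \<Longrightarrow> up M k x \<in> U (k + 1)"
    "k \<in> {1..<n} \<Longrightarrow> x \<in> U (k + 1) \<Longrightarrow> dn M k x \<in> U k"
  using assms unfolding is_sub_def by blast+

lemma is_sub_image:
  assumes M: "is_rep n M" and U: "is_sub n U M" and f: "is_hom n M N f"
  shows "is_sub n (\<lambda>k. f k ` U k) N"
  unfolding is_sub_def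
proof (intro conjI ballI)
  fix k assume k: "k \<in> {1..n}"
  show "fvec.subspace (f k ` U k)"
    by (rule lin_map_subspaces(2)[OF is_hom_lin[OF f k] is_rep_subspace[OF M k] is_subD(1,2)[OF U k]])
  show "f k ` U k \<subseteq> spc N k" using is_hom_in[OF f k] is_subD(2)[OF U k] by blast
next
  fix k assume k: "k \<in> {1..<n}"
  then have k': "k \<in> {1..n}" "k + 1 \<in> {1..n}" by auto
  show "up N k ` (f k ` U k) \<subseteq> f (k + 1) ` U (k + 1)"
  proof (intro image_subsetI)
    fix x assume "x \<in> f k ` U k"
    then obtain y where y: "y \<in> U k" "x = f k y" by blast
    then have "up N k x = f (k + 1) (up M k y)"
      using f k is_subD(2)[OF U k'(1)] unfolding is_hom_def by fastforce
    then show "up N k x \<in> f (k + 1) ` U (k + 1)" using is_subD(3)[OF U k y(1)] by simp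
  qed
  show "dn N k ` (f (k + 1) ` U (k + 1)) \<subseteq> f k ` U k"
  proof (intro image_subsetI)
    fix x assume "x \<in> f (k + 1) ` U (k + 1)"
    then obtain y where y: "y \<in> U (k + 1)" "x = f (k + 1) y" by blast
    then have "dn N k x = f k (dn M k y)"
      using f k is_subD(2)[OF U k'(2)] unfolding is_hom_def by fastforce
    then show "dn N k x \<in> f k ` U k" using is_subD(4)[OF U k y(1)] by simp
  qed
qed

lemma is_sub_spc: "is_rep n M \<Longrightarrow> is_sub n (spc M) M"
  using is_rep_subspace[of n M] is_rep_arrows[of n M] unfolding is_sub_def lin_map_def by simp

lemma restr_simps [simp]: "spc (restr M U) = U" "up (restr M U) = up M" "dn (restr M U) = dn M"
  by (auto simp: restr_def)

lemma is_rep_restr: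
  assumes M: "is_rep n M" and U: "is_sub n U M"
  shows "is_rep n (restr M U)"
proof -
  have "fd_subspace (U k)" if "k \<in> {1..n}" for k
    using fd_subspace_subset(1)[of "spc M k" "U k"] that M U unfolding is_rep_def is_sub_def by simp
  moreover have sub: "U k \<subseteq> spc M k" if "k \<in> {1..n}" for k using that U unfolding is_sub_def by simp
  moreover have "lin_map (U k) (U (k + 1)) (up M k) \<and> lin_map (U (k + 1)) (U k) (dn M k)
      \<and> (\<forall>x\<in>U k. dn M k (up M k x) = 0) \<and> (\<forall>x\<in>U (k + 1). up M k (dn M k x) = 0)"
    if k: "k \<in> {1..<n}" for k
  proof -
    have "U k \<subseteq> spc M k" "U (k + 1) \<subseteq> spc M (k + 1)" using sub[of k] sub[of "k+1"] k by auto
    moreover have "up M k ` U k \<subseteq> U (k + 1)" "dn M k ` U (k + 1) \<subseteq> U k"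
      using U k unfolding is_sub_def by blast+
    ultimately show ?thesis
      using is_rep_arrows[OF M, of k] k unfolding lin_map_def by (auto simp: subset_iff)
  qed
  ultimately show ?thesis unfolding is_rep_def by simp
qed

lemma is_mono_restr: "is_sub n U M \<Longrightarrow> is_mono n (restr M U) M (\<lambda>k x. x)"
  by (auto simp: is_mono_def is_hom_def lin_map_def is_sub_def)

lemma short_exact_kern:
  assumes "is_rep n M" "is_rep n N" "is_epi n M N f"
  shows "short_exact n (restr M (kern M f)) M N (\<lambda>k x. x) f"
  using assms is_mono_restr[OF is_sub_kern] unfolding short_exact_def is_epi_def by (auto simp: kern_def)

text \<open>A direct summand given by maps: \<open>s\<close> embeds \<open>X\<close>,
  \<open>q\<close> retracts onto it, and \<open>kern M q\<close> is the complement. Such maps are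
  what the construction of strings produces.\<close>

definition retract :: "nat \<Rightarrow> 'k::field rep \<Rightarrow> 'k rep \<Rightarrow> (nat \<Rightarrow> (nat \<Rightarrow> 'k) \<Rightarrow> (nat \<Rightarrow> 'k)) \<Rightarrow>
    (nat \<Rightarrow> (nat \<Rightarrow> 'k) \<Rightarrow> (nat \<Rightarrow> 'k)) \<Rightarrow> bool" where
  "retract n M X q s \<longleftrightarrow> is_hom n M X q \<and> is_hom n X M s \<and> (\<forall>k\<in>{1..n}. \<forall>y\<in>spc X k. q k (s k y) = y)"

lemma retract_epi: "retract n M X q s \<Longrightarrow> is_epi n M X q"
  (is "?R \<Longrightarrow> _")
proof -
  assume r: ?R
  have "y \<in> q k ` spc M k" if "k \<in> {1..n}" "y \<in> spc X k" for k y
  proof (rule image_eqI)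
    show "y = q k (s k y)" using r that unfolding retract_def by simp
    show "s k y \<in> spc M k" using r that is_hom_in unfolding retract_def by blast
  qed
  moreover have "q k ` spc M k \<subseteq> spc X k" if "k \<in> {1..n}" for k
    using r that is_hom_in unfolding retract_def by blast
  ultimately show ?thesis using r unfolding is_epi_def retract_def by blast
qed

text \<open>The idempotent \<open>1 - s q\<close> projects onto the kernel of \<open>q\<close> along
  the image of \<open>s\<close>. So this submodule is also a quotient, and torsion classes are
  closed under quotients.\<close>

lemma retract_projection:
  assumes M: "is_rep n M" and X: "is_rep n X" and r: "retract n M X q s"
  shows "is_epi n M (restr M (kern M q)) (\<lambda>k x. x - s k (q k x))"
    and "k \<in> {1..n} \<Longrightarrow> x \<in> kern M q k \<Longrightarrow> x - s k (q k x) = x"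
proof -
  let ?e = "\<lambda>k x. s k (q k x)"
  have q: "is_hom n M X q" and s: "is_hom n X M s" using r retract_def by blast+
  have e: "is_hom n M M ?e" using is_hom_comp q s by blast
  have 1: "x - ?e k x \<in> kern M q k" if "k \<in> {1..n}" "x \<in> spc M k" for k x
    using that fvec.subspace_diff[OF is_rep_subspace[OF M that(1)] that(2)] is_hom_in[OF e that]
      lin_map_diff[OF is_hom_lin[OF q] is_rep_subspace[OF M], of k x "?e k x"]
      r is_hom_in[OF q that]
    unfolding retract_def kern_def by auto
  show 2: "x - ?e k x = x" if "k \<in> {1..n}" "x \<in> kern M q k" for k x
    using that is_hom_zero[OF X s] by (simp add: kern_def)
  have "lin_map (spc M k) (kern M q k) (\<lambda>x. x - ?e k x)" if k: "k \<in> {1..n}" for k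
    using is_hom_lin[OF e k] 1[OF k] unfolding lin_map_def
    by (auto simp: algebra_simps fvec.scale_right_diff_distrib)
  moreover have "up M k x - ?e (k + 1) (up M k x) = up M k (x - ?e k x)" if "k \<in> {1..<n}" "x \<in> spc M k" for k x
    using that lin_map_diff[OF is_rep_arrows(1)[OF M, of k] is_rep_subspace[OF M, of k], of x "?e k x"]
      is_hom_in[OF e, of k x] e unfolding is_hom_def by auto
  moreover have "dn M k x - ?e k (dn M k x) = dn M k (x - ?e (k + 1) x)" if "k \<in> {1..<n}" "x \<in> spc M (k + 1)" for k x
    using that lin_map_diff[OF is_rep_arrows(2)[OF M, of k] is_rep_subspace[OF M, of "k + 1"], of x "?e (k + 1) x"]
      is_hom_in[OF e, of "k + 1" x] e unfolding is_hom_def by auto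
  ultimately have hom: "is_hom n M (restr M (kern M q)) (\<lambda>k x. x - ?e k x)"
    unfolding is_hom_def by simp
  have "(\<lambda>x. x - ?e k x) ` spc M k = kern M q k" if k: "k \<in> {1..n}" for k
  proof
    show "kern M q k \<subseteq> (\<lambda>x. x - ?e k x) ` spc M k"
    proof
      fix x assume x: "x \<in> kern M q k"
      then have "x \<in> spc M k" by (simp add: kern_def)
      then show "x \<in> (\<lambda>x. x - ?e k x) ` spc M k"
        by (rule image_eqI[where f = "\<lambda>x. x - ?e k x" and x = x, rotated]) (rule 2[OF k x, symmetric])
    qed
  qed (use 1[OF k] in blast)
  then show "is_epi n M (restr M (kern M q)) (\<lambda>k x. x - ?e k x)" using hom by (simp add: is_epi_def)
qed

definition length_rep :: "nat \<Rightarrow> 'k::field rep \<Rightarrow> nat" where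
  "length_rep n M = (\<Sum>k\<in>{1..n}. fvec.dim (spc M k))"

lemma length_rep_sub_less:
  assumes "is_rep n M" "is_sub n U M" "k \<in> {1..n}" "U k \<noteq> spc M k"
  shows "length_rep n (restr M U) < length_rep n M"
  unfolding length_rep_def
proof (rule sum_strict_mono_ex1)
  have *: "fd_subspace (spc M k)" "fvec.subspace (U k)" "U k \<subseteq> spc M k" if "k \<in> {1..n}" for k
    using that assms unfolding is_rep_def is_sub_def by auto
  show "\<forall>k\<in>{1..n}. fvec.dim (spc (restr M U) k) \<le> fvec.dim (spc M k)"
    using fd_subspace_subset(2)[OF *] by simp
  show "\<exists>k\<in>{1..n}. fvec.dim (spc (restr M U) k) < fvec.dim (spc M k)"
    using fd_subspace_subset(3)[OF *[OF assms(3)] assms(4)] assms(3) by auto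
qed simp

section \<open>Torsion classes\<close>

lemma torsion_class_rep: "torsion_class n T \<Longrightarrow> M \<in> T \<Longrightarrow> is_rep n M"
  unfolding torsion_class_def by (elim conjE) (erule (1) bspec)

lemma torsion_class_quot:
  assumes T: "torsion_class n T" and M: "M \<in> T" and N: "is_rep n N" and f: "is_epi n M N f"
  shows "N \<in> T"
proof -
  have "is_sub n (kern M f) M"
    using f is_sub_kern[OF torsion_class_rep[OF T M] N] unfolding is_epi_def by blast
  moreover have "quot_iso n M (kern M f) N" using f unfolding quot_iso_def kern_def by blast
  ultimately show ?thesis using T M N unfolding torsion_class_def by blast
qed

lemma torsion_class_ext:
  "torsion_class n T \<Longrightarrow> A \<in> T \<Longrightarrow> C \<in> T \<Longrightarrow> is_rep n B \<Longrightarrow> short_exact n A B C f g \<Longrightarrow> B \<in> T"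
  unfolding torsion_class_def by blast

text \<open>Isomorphisms are epimorphisms and \<open>quot_iso\<close> supplies one, so closure under
  epimorphic images covers two clauses of the definition.\<close>

lemma torsion_classI:
  assumes "T \<noteq> {}" "\<And>M. M \<in> T \<Longrightarrow> is_rep n M"
    and "\<And>M N f. M \<in> T \<Longrightarrow> is_rep n N \<Longrightarrow> is_epi n M N f \<Longrightarrow> N \<in> T"
    and "\<And>A B C f g. A \<in> T \<Longrightarrow> C \<in> T \<Longrightarrow> is_rep n B \<Longrightarrow> short_exact n A B C f g \<Longrightarrow> B \<in> T"
  shows "torsion_class n T"
proof -
  have "\<forall>M\<in>T. \<forall>U N. is_sub n U M \<and> is_rep n N \<and> quot_iso n M U N \<longrightarrow> N \<in> T"
    using assms(3) unfolding quot_iso_def by blast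
  moreover have "\<forall>M\<in>T. \<forall>N. is_rep n N \<and> isomorphic n M N \<longrightarrow> N \<in> T"
    using assms(3) unfolding isomorphic_def by blast
  moreover have "\<forall>A\<in>T. \<forall>C\<in>T. \<forall>B f g. is_rep n B \<and> short_exact n A B C f g \<longrightarrow> B \<in> T"
    using assms(4) by blast
  moreover have "\<forall>M\<in>T. is_rep n M"
    using assms(2) by blast
  ultimately show ?thesis using assms(1) unfolding torsion_class_def
    by (intro conjI)
qed

text \<open>Many records are zero modules, as values off the vertices \<open>1..n\<close> are
  ignored. The zero map makes each of them a quotient of any member.\<close>

lemma torsion_class_zero:
  assumes T: "torsion_class n T" and N: "is_rep n N" "is_zero n N"
  shows "N \<in> T"
proof -
  have "T \<noteq> {}" using T unfolding torsion_class_def by (elim conjE)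
  then obtain M where M: "M \<in> T" by blast
  have N0: "spc N k = {0}" if "k \<in> {1..n}" for k
    using N that unfolding is_zero_def support_def by blast
  have "is_hom n M N (\<lambda>k x. 0)"
    using N0 lin_map_subspaces(1)[OF is_rep_arrows(1)[OF N(1)] is_rep_subspace[OF N(1)]]
      lin_map_subspaces(1)[OF is_rep_arrows(2)[OF N(1)] is_rep_subspace[OF N(1)]]
    by (auto simp: is_hom_def lin_map_def)
  moreover have "spc M k \<noteq> {}" if "k \<in> {1..n}" for k
    using is_rep_subspace[OF torsion_class_rep[OF T M] that] fvec.subspace_0 by blast
  ultimately have "is_epi n M N (\<lambda>k x. 0)"
    using N0 by (simp add: is_epi_def image_constant_conv)
  then show ?thesis using torsion_class_quot T M N(1) by blast
qed

section \<open>String modules\<close>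

text \<open>All nonzero spaces of all strings are the line spanned by this one vector, so arrows and
  maps between strings can be the identity or zero.\<close>

definition e0 :: "nat \<Rightarrow> 'k::field" where
  "e0 = (\<lambda>j. if j = 0 then 1 else 0)"

text \<open>The module \<open>str i j d\<close> has support \<open>{i<..j}\<close>, so that its \<^const>\<open>inv_mod\<close> is \<open>(i, j)\<close>; the
  edge between \<open>k\<close> and \<open>k + 1\<close> carries the identity of \<open>a\<^sub>k\<close> if \<open>d k\<close>, and of \<open>a\<^sub>k\<^sup>*\<close> otherwise.
  Restricting the guards to \<open>i < k < j\<close> makes \<open>str i j d\<close> independent of the other values of \<open>d\<close>.\<close>

definition str :: "nat \<Rightarrow> nat \<Rightarrow> (nat \<Rightarrow> bool) \<Rightarrow> 'k::field rep" where
  "str i j d = \<lparr>spc = (\<lambda>k. if i < k \<and> k \<le> j then range (\<lambda>c. fscale c e0) else {0}),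
     up = (\<lambda>k x. if i < k \<and> k < j \<and> d k then x else 0),
     dn = (\<lambda>k x. if i < k \<and> k < j \<and> \<not> d k then x else 0)\<rparr>"

lemma str_cong:
  assumes "\<And>k. i < k \<Longrightarrow> k < j \<Longrightarrow> d k = d' k"
  shows "str i j d = str i j d'"
  using assms by (auto simp: str_def fun_eq_iff)

lemma up_str: "up (str i j d) k x = (if i < k \<and> k < j \<and> d k then x else 0)"
  and dn_str: "dn (str i j d) k x = (if i < k \<and> k < j \<and> \<not> d k then x else 0)"
  by (auto simp: str_def)

lemma spc_str: "spc (str i j d) k = (if i < k \<and> k \<le> j then range (\<lambda>c. fscale c e0) else {0})"
  by (simp add: str_def)

lemma e0_simps [simp]: "e0 0 = 1" "fscale c x 0 = c * x 0" "e0 \<noteq> 0"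
  by (auto simp: e0_def fscale_def fun_eq_iff)

lemma fscale_eq_0_iff [simp]: "fscale c e0 = 0 \<longleftrightarrow> c = 0"
  by (auto simp: e0_def fscale_def fun_eq_iff)

lemma range_e0: "range (\<lambda>c. fscale c e0) = fvec.span {e0}"
  by (simp add: fvec.span_singleton)

lemma spc_str_coord: "x \<in> spc (str i j d) k \<Longrightarrow> fscale (x 0) e0 = x"
  by (auto simp: spc_str split: if_splits)

lemma e0_in_str: "i < k \<Longrightarrow> k \<le> j \<Longrightarrow> e0 \<in> spc (str i j d) k"
  using rangeI[of "\<lambda>c. fscale c e0" 1] by (simp add: spc_str)

lemma is_rep_str: "is_rep n (str i j d)"
proof -
  have "fd_subspace (spc (str i j d) k)" for k
  proof -
    have "spc (str i j d) k = fvec.span (if i < k \<and> k \<le> j then {e0} else {})"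
      by (cases "i < k \<and> k \<le> j") (simp_all only: spc_str range_e0 fvec.span_empty if_True if_False simp_thms)
    then show ?thesis unfolding fd_subspace_def by (metis finite.emptyI finite_insert)
  qed
  moreover have "lin_map (spc (str i j d) k) (spc (str i j d) (k + 1)) (up (str i j d) k)" for k
    by (auto simp: lin_map_def up_str spc_str image_subset_iff)
  moreover have "lin_map (spc (str i j d) (k + 1)) (spc (str i j d) k) (dn (str i j d) k)" for k
    by (auto simp: lin_map_def dn_str spc_str image_subset_iff)
  ultimately show ?thesis
    unfolding is_rep_def by (auto simp: up_str dn_str)
qed

lemma spc_str_eq_0_iff: "spc (str i j d) k = {0} \<longleftrightarrow> \<not> (i < k \<and> k \<le> j)"
  using e0_in_str[of i k j d] e0_simps(3) by (cases "i < k \<and> k \<le> j") (blast | simp add: spc_str)+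

lemma support_str: "j \<le> n \<Longrightarrow> support n (str i j d) = {i<..j}"
  by (auto simp: support_def spc_str_eq_0_iff)

lemma inv_mod_str: "i < j \<Longrightarrow> j \<le> n \<Longrightarrow> inv_mod n (str i j d) = (i, j)"
proof -
  assume "i < j" "j \<le> n"
  then have "Min {i<..j} = Suc i" "Max {i<..j} = j"
    by (auto intro!: Min_eqI Max_eqI)
  then show ?thesis using \<open>j \<le> n\<close> by (simp add: inv_mod_def support_str)
qed

section \<open>Strings as direct summands\<close>

text \<open>On the vertices up to \<open>i\<close>, \<open>xs\<close> is a map from the string on
  (a, i] to \<open>M\<close> and \<open>\<phi>s\<close> a map back. Conditions are imposed only on
  the arrows along the string; those on the opposite arrows follow from the two-cycle relations. The
  last conjunct closes the left end, where for \<open>a = 0\<close> there is no arrow. The right end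
  stays open for extension.\<close>

definition str_pair :: "'k::field rep \<Rightarrow> nat \<Rightarrow> nat \<Rightarrow> (nat \<Rightarrow> bool) \<Rightarrow>
    (nat \<Rightarrow> (nat \<Rightarrow> 'k)) \<Rightarrow> (nat \<Rightarrow> (nat \<Rightarrow> 'k) \<Rightarrow> 'k) \<Rightarrow> bool" where
  "str_pair M a i d xs \<phi>s \<longleftrightarrow> a < i \<and>
     (\<forall>k. a < k \<and> k \<le> i \<longrightarrow> xs k \<in> spc M k \<and> lin_fun (spc M k) (\<phi>s k) \<and> \<phi>s k (xs k) = 1) \<and>
     (\<forall>k. a < k \<and> k < i \<and> d k \<longrightarrow>
        up M k (xs k) = xs (k + 1) \<and> (\<forall>y\<in>spc M k. \<phi>s (k + 1) (up M k y) = \<phi>s k y)) \<and>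
     (\<forall>k. a < k \<and> k < i \<and> \<not> d k \<longrightarrow>
        dn M k (xs (k + 1)) = xs k \<and> (\<forall>y\<in>spc M (k + 1). \<phi>s k (dn M k y) = \<phi>s (k + 1) y)) \<and>
     (1 \<le> a \<longrightarrow> dn M a (xs (a + 1)) = 0 \<and> (\<forall>y\<in>spc M a. \<phi>s (a + 1) (up M a y) = 0))"

text \<open>A layer is good if each vector and functional that pair nontrivially on it extend
  to the left to maps from and to a string.\<close>

definition good_layer :: "'k::field rep \<Rightarrow> nat \<Rightarrow> (nat \<Rightarrow> 'k) set \<Rightarrow> (nat \<Rightarrow> 'k) set \<Rightarrow> bool" where
  "good_layer M i V W \<longleftrightarrow> fvec.subspace V \<and> fvec.subspace W \<and> V \<subseteq> W \<and> W \<subseteq> spc M i \<and>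
     (\<forall>x\<in>W. \<forall>\<phi>. lin_fun (spc M i) \<phi> \<and> (\<forall>v\<in>V. \<phi> v = 0) \<and> \<phi> x = 1 \<longrightarrow>
        (\<exists>a d xs \<phi>s. str_pair M a i d xs \<phi>s \<and> xs i = x \<and> \<phi>s i = \<phi>))"

lemma str_pair_snoc:
  assumes "str_pair M a i d xs \<phi>s" "x \<in> spc M (i + 1)" "lin_fun (spc M (i + 1)) \<phi>" "\<phi> x = 1"
    and "b \<Longrightarrow> up M i (xs i) = x \<and> (\<forall>y\<in>spc M i. \<phi> (up M i y) = \<phi>s i y)"
    and "\<not> b \<Longrightarrow> dn M i x = xs i \<and> (\<forall>y\<in>spc M (i + 1). \<phi>s i (dn M i y) = \<phi> y)"
  shows "str_pair M a (i + 1) (d(i := b)) (xs(i + 1 := x)) (\<phi>s(i + 1 := \<phi>))"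
  using assms unfolding str_pair_def by (auto simp: less_Suc_eq le_Suc_eq)

text \<open>Along \<open>up\<close> the functional is pulled back and the vector is replaced by a
  preimage.\<close>

lemma good_layer_up:
  assumes M: "is_rep n M" and i: "1 \<le> i" "i < n" and g: "good_layer M i V W"
  shows "good_layer M (i + 1) (up M i ` V) (up M i ` W)"
proof -
  note ar = is_rep_arrows[OF M i]
  have Vi: "fvec.subspace (spc M i)" using is_rep_subspace[OF M] i by simp
  have ex: "\<exists>a d xs \<phi>s. str_pair M a (i + 1) d xs \<phi>s \<and> xs (i + 1) = x' \<and> \<phi>s (i + 1) = \<phi>'"
    if x': "x' \<in> up M i ` W" and \<phi>': "lin_fun (spc M (i + 1)) \<phi>'" "\<forall>v\<in>up M i ` V. \<phi>' v = 0" "\<phi>' x' = 1" for x' \<phi>'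
  proof -
    obtain x where x: "x \<in> W" "x' = up M i x" using x' by blast
    have xM: "x \<in> spc M i" using x g unfolding good_layer_def by blast
    define \<phi> where "\<phi> = (\<lambda>y. \<phi>' (up M i y))"
    have "lin_fun (spc M i) \<phi>"
      using \<phi>'(1) ar(1) lin_map_in[OF ar(1)] unfolding \<phi>_def lin_fun_def lin_map_def by simp
    moreover have "\<forall>v\<in>V. \<phi> v = 0" "\<phi> x = 1" using \<phi>' x by (auto simp: \<phi>_def)
    ultimately obtain a d xs \<phi>s where s: "str_pair M a i d xs \<phi>s" "xs i = x" "\<phi>s i = \<phi>"
      using g x(1) unfolding good_layer_def by metis
    have "str_pair M a (i + 1) (d(i := True)) (xs(i + 1 := x')) (\<phi>s(i + 1 := \<phi>'))"
      by (rule str_pair_snoc[OF s(1)]) (use \<phi>' x s xM lin_map_in[OF ar(1)] in \<open>auto simp: \<phi>_def\<close>)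
    then show ?thesis by (metis fun_upd_same)
  qed
  have "V \<subseteq> spc M i" "W \<subseteq> spc M i" "fvec.subspace V" "fvec.subspace W" "V \<subseteq> W"
    using g unfolding good_layer_def by auto
  moreover have "up M i ` W \<subseteq> spc M (i + 1)" using \<open>W \<subseteq> spc M i\<close> lin_map_in[OF ar(1)] by blast
  ultimately show ?thesis
    unfolding good_layer_def using ex lin_map_subspaces(2)[OF ar(1) Vi] by (simp add: image_mono)
qed

text \<open>Along \<open>dn\<close> the roles are exchanged: the vector is mapped, and the
  functional has to factor through \<open>dn\<close> and vanish on \<open>V\<close>, which is what
  \<open>factor_functional\<close> provides.\<close>

lemma good_layer_dn:
  assumes M: "is_rep n M" and i: "1 \<le> i" "i < n" and g: "good_layer M i V W"
  defines "pre \<equiv> \<lambda>U. {y \<in> spc M (i + 1). dn M i y \<in> U}"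
  shows "good_layer M (i + 1) (pre V) (pre W)"
proof -
  note ar = is_rep_arrows[OF M i]
  have Vi: "fvec.subspace (spc M (i + 1))" using is_rep_subspace[OF M] i by simp
  have sub: "V \<subseteq> spc M i" "W \<subseteq> spc M i" "fvec.subspace V" "fvec.subspace W" "V \<subseteq> W"
    using g unfolding good_layer_def by auto
  have ex: "\<exists>a d xs \<phi>s. str_pair M a (i + 1) d xs \<phi>s \<and> xs (i + 1) = x' \<and> \<phi>s (i + 1) = \<phi>'"
    if x': "x' \<in> pre W" and \<phi>': "lin_fun (spc M (i + 1)) \<phi>'" "\<forall>v\<in>pre V. \<phi>' v = 0" "\<phi>' x' = 1" for x' \<phi>'
  proof -
    have x: "x' \<in> spc M (i + 1)" "dn M i x' \<in> W" using x' by (auto simp: pre_def)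
    obtain \<psi> where \<psi>: "lin_fun UNIV \<psi>" "\<And>v. v \<in> V \<Longrightarrow> \<psi> v = 0"
      "\<And>v. v \<in> spc M (i + 1) \<Longrightarrow> \<psi> (dn M i v) = \<phi>' v"
      by (rule factor_functional[OF ar(2) Vi sub(3) \<phi>'(1) x(1) \<phi>'(3)]) (use \<phi>'(2) in \<open>auto simp: pre_def\<close>)
    have "lin_fun (spc M i) \<psi>" using \<psi>(1) lin_fun_subset by blast
    moreover have "\<forall>v\<in>V. \<psi> v = 0" "\<psi> (dn M i x') = 1" using \<psi> \<phi>' x by auto
    ultimately obtain a d xs \<phi>s where s: "str_pair M a i d xs \<phi>s" "xs i = dn M i x'" "\<phi>s i = \<psi>"
      using g x(2) unfolding good_layer_def by metis
    have "str_pair M a (i + 1) (d(i := False)) (xs(i + 1 := x')) (\<phi>s(i + 1 := \<phi>'))"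
      by (rule str_pair_snoc[OF s(1)]) (use \<phi>' x s \<psi> in auto)
    then show ?thesis by (metis fun_upd_same)
  qed
  have "pre V \<subseteq> pre W" "pre W \<subseteq> spc M (i + 1)" using sub by (auto simp: pre_def)
  then show ?thesis
    unfolding good_layer_def using ex sub lin_map_subspaces(3)[OF ar(2) Vi] by (simp add: pre_def)
qed

text \<open>The string with the single vertex \<open>a + 1\<close> does: the arrow to the left kills
  the vectors of \<open>W\<close>, and the functionals, vanishing on \<open>V\<close>, kill what
  arrives from the left.\<close>

lemma good_layer_start:
  assumes "fvec.subspace V" "fvec.subspace W" "V \<subseteq> W" "W \<subseteq> spc M (a + 1)"
    and "1 \<le> a \<Longrightarrow> (\<forall>x\<in>W. dn M a x = 0) \<and> (\<forall>y\<in>spc M a. up M a y \<in> V)"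
  shows "good_layer M (a + 1) V W"
proof -
  have "\<exists>a' d xs \<phi>s. str_pair M a' (a + 1) d xs \<phi>s \<and> xs (a + 1) = x \<and> \<phi>s (a + 1) = \<phi>"
    if "x \<in> W" "lin_fun (spc M (a + 1)) \<phi>" "\<forall>v\<in>V. \<phi> v = 0" "\<phi> x = 1" for x \<phi>
  proof -
    have "str_pair M a (a + 1) (\<lambda>_. True) (\<lambda>_. x) (\<lambda>_. \<phi>)"
      using that assms unfolding str_pair_def by (auto simp: le_Suc_eq)
    then show ?thesis by metis
  qed
  then show ?thesis using assms unfolding good_layer_def by blast
qed

text \<open>A filtration is encoded as a path in the relation \<open>good_layer M i\<close>, so the
  two halves are obtained by mapping paths and joined by transitivity.\<close>

lemma good_filtration:
  assumes M: "is_rep n M" and i: "1 \<le> i" "i \<le> n"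
  shows "(good_layer M i)\<^sup>*\<^sup>* {0} (spc M i)"
  using i
proof (induction i rule: dec_induct)
  case base
  \<comment> \<open>At the leftmost vertex there is no arrow on the left, so the whole space is a
    single layer.\<close>
  have "good_layer M (0 + 1) {0} (spc M (0 + 1))"
    by (rule good_layer_start)
      (use is_rep_subspace[OF M, of 1] i in \<open>auto simp: fvec.subspace_single_0 fvec.subspace_0\<close>)
  then show ?case by (metis add_0 r_into_rtranclp)
next
  case (step i)
  then have i: "1 \<le> i" "i < n" "i \<in> {1..n}" "i + 1 \<in> {1..n}" by auto
  note ar = is_rep_arrows[OF M i(1,2)]
  let ?G = "good_layer M (i + 1)"
  let ?pre = "\<lambda>U. {y \<in> spc M (i + 1). dn M i y \<in> U}"
  have sub: "fvec.subspace (spc M i)" "fvec.subspace (spc M (i + 1))"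
    using is_rep_subspace[OF M] i by auto
  have IH: "(good_layer M i)\<^sup>*\<^sup>* {0} (spc M i)" by (rule step.IH) (use i in auto)
  have 1: "?G\<^sup>*\<^sup>* (up M i ` {0}) (up M i ` spc M i)"
    using IH
  proof (induction rule: rtranclp_induct)
    case base
    show ?case by (rule rtranclp.rtrancl_refl)
  next
    case (step V W)
    then show ?case using good_layer_up[OF M i(1,2), of V W] by (meson rtranclp.rtrancl_into_rtrancl)
  qed
  have 2: "?G\<^sup>*\<^sup>* (?pre {0}) (?pre (spc M i))"
    using IH
  proof (induction rule: rtranclp_induct)
    case base
    show ?case by (rule rtranclp.rtrancl_refl)
  next
    case (step V W)
    then show ?case using good_layer_dn[OF M i(1,2), of V W] by (meson rtranclp.rtrancl_into_rtrancl)
  qed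
  \<comment> \<open>The halves fit together because a two-cycle is zero: the image of
    \<open>up\<close> lies in the kernel of \<open>dn\<close>. Strings starting at
    \<open>i + 1\<close> arise in this layer.\<close>
  have 3: "?G (up M i ` spc M i) (?pre {0})"
  proof (rule good_layer_start)
    show "fvec.subspace (up M i ` spc M i)"
      by (rule lin_map_subspaces(2)[OF ar(1) sub(1) sub(1)]) simp
    show "fvec.subspace (?pre {0})"
      by (rule lin_map_subspaces(3)[OF ar(2) sub(2)]) (rule fvec.subspace_single_0)
    show "up M i ` spc M i \<subseteq> ?pre {0}"
      using ar(3) lin_map_in[OF ar(1)] by auto
  qed auto
  have "?pre (spc M i) = spc M (i + 1)" using lin_map_in[OF ar(2)] by auto
  moreover have "up M i ` {0} = {0}" using lin_map_subspaces(1)[OF ar(1) sub(1)] by simp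
  ultimately have 4: "?G\<^sup>*\<^sup>* {0} (up M i ` spc M i)" "?G\<^sup>*\<^sup>* (?pre {0}) (spc M (i + 1))"
    using 1 2 by auto
  have "?G\<^sup>*\<^sup>* {0} (spc M (i + 1))"
    by (rule rtranclp_trans[OF rtranclp.rtrancl_into_rtrancl[OF 4(1) 3] 4(2)])
  then show ?case by (simp only: Suc_eq_plus1)
qed

text \<open>Beyond the last vertex of the support all spaces are zero, so a pair of vectors and
  functionals ending there extends by zero to homomorphisms in both directions.\<close>

lemma string_retract:
  assumes M: "is_rep n M" and nz: "\<not> is_zero n M"
  obtains a r d q s where "a < r" "r \<le> n" "retract n M (str a r d) q s"
proof -
  define r where "r = Max (support n M)"
  have fin: "finite (support n M)" by (simp add: support_def)
  have "r \<in> support n M"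
    using nz fin unfolding r_def is_zero_def by (rule Max_in[rotated])
  then have r: "1 \<le> r" "r \<le> n" "spc M r \<noteq> {0}" by (auto simp: support_def)
  have last: "spc M k = {0}" if "r < k" "k \<le> n" for k
  proof (rule ccontr)
    assume "spc M k \<noteq> {0}"
    then have "k \<in> support n M" using that by (auto simp: support_def)
    then show False using that Max_ge[OF fin] r_def by fastforce
  qed
  \<comment> \<open>A path from 0 to a nonzero space has a layer that is not trivial.\<close>
  have "\<exists>V W. good_layer M r V W \<and> V \<noteq> W"
  proof (rule ccontr)
    assume *: "\<not> ?thesis"
    have "(good_layer M r)\<^sup>*\<^sup>* {0} (spc M r)" using good_filtration[OF M r(1,2)] .
    then have "{0} = spc M r" by (induction rule: rtranclp_induct) (use * in auto)
    then show False using r(3) by simp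
  qed
  then obtain V W x where VW: "good_layer M r V W" "x \<in> W" "x \<notin> V"
    unfolding good_layer_def by blast
  then have "fvec.subspace V" unfolding good_layer_def by blast
  then obtain \<phi> where \<phi>: "lin_fun UNIV \<phi>" "\<And>v. v \<in> V \<Longrightarrow> \<phi> v = 0" "\<phi> x = 1"
    using separating_functional VW(3) by blast
  then obtain a d xs \<phi>s where s: "str_pair M a r d xs \<phi>s"
    using VW lin_fun_subset[OF \<phi>(1)] unfolding good_layer_def by (metis subset_UNIV)
  then have a: "a < r" and xs: "\<And>k. a < k \<Longrightarrow> k \<le> r \<Longrightarrow> xs k \<in> spc M k"
    and \<phi>s: "\<And>k. a < k \<Longrightarrow> k \<le> r \<Longrightarrow> lin_fun (spc M k) (\<phi>s k)"
    and one: "\<And>k. a < k \<Longrightarrow> k \<le> r \<Longrightarrow> \<phi>s k (xs k) = 1"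
    and ups: "\<And>k. a < k \<Longrightarrow> k < r \<Longrightarrow> d k \<Longrightarrow> up M k (xs k) = xs (k + 1)"
      "\<And>k y. a < k \<Longrightarrow> k < r \<Longrightarrow> d k \<Longrightarrow> y \<in> spc M k \<Longrightarrow> \<phi>s (k + 1) (up M k y) = \<phi>s k y"
    and dns: "\<And>k. a < k \<Longrightarrow> k < r \<Longrightarrow> \<not> d k \<Longrightarrow> dn M k (xs (k + 1)) = xs k"
      "\<And>k y. a < k \<Longrightarrow> k < r \<Longrightarrow> \<not> d k \<Longrightarrow> y \<in> spc M (k + 1) \<Longrightarrow> \<phi>s k (dn M k y) = \<phi>s (k + 1) y"
    and start: "1 \<le> a \<Longrightarrow> dn M a (xs (a + 1)) = 0"
      "\<And>y. 1 \<le> a \<Longrightarrow> y \<in> spc M a \<Longrightarrow> \<phi>s (a + 1) (up M a y) = 0"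
    unfolding str_pair_def by blast+
  let ?X = "str a r d :: 'a rep"
  \<comment> \<open>\<open>q\<close> records the value of the functional as a multiple of
    \<open>e0\<close>; \<open>t\<close> reads that multiple off as the coordinate \<open>y 0\<close>
    and applies it to the vector.\<close>
  define q where "q = (\<lambda>k y. if a < k \<and> k \<le> r then fscale (\<phi>s k y) e0 else 0 :: nat \<Rightarrow> 'a)"
  define t where "t = (\<lambda>k (y :: nat \<Rightarrow> 'a). if a < k \<and> k \<le> r then fscale (y 0) (xs k) else 0)"
  have sub: "fvec.subspace (spc M k)" if "k \<in> {1..n}" for k using is_rep_subspace[OF M that] .
  have \<phi>0: "\<phi>s k 0 = 0" if "a < k" "k \<le> r" for k
    using lin_fun_diff[OF \<phi>s[OF that] sub xs[OF that] xs[OF that]] that r by auto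
  have scale_arrow: "up M k (fscale c x) = fscale c (up M k x)" if "x \<in> spc M k" "k \<in> {1..<n}" for c k x
    using is_rep_arrows(1)[OF M, of k] that unfolding lin_map_def by simp
  have scale_arrow': "dn M k (fscale c x) = fscale c (dn M k x)" if "x \<in> spc M (k + 1)" "k \<in> {1..<n}" for c k x
    using is_rep_arrows(2)[OF M, of k] that unfolding lin_map_def by simp
  have arrow0: "up M k 0 = 0" "dn M k 0 = 0" if "k \<in> {1..<n}" for k
    using lin_map_subspaces(1)[OF is_rep_arrows(1)[OF M] sub, of k] lin_map_subspaces(1)[OF is_rep_arrows(2)[OF M] sub, of k] that
    by auto
  have q: "is_hom n M ?X q"
    unfolding is_hom_def
  proof (intro conjI ballI)
    fix k assume "k \<in> {1..n}"
    then show "lin_map (spc M k) (spc ?X k) (q k)"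
      using \<phi>s[of k] by (auto simp: lin_map_def q_def spc_str lin_fun_def fvec.scale_left_distrib)
  next
    fix k y assume k: "k \<in> {1..<n}" and y: "y \<in> spc M k"
    consider "k < a" | "k = a" | "a < k" "k < r" "d k" | "a < k" "k < r" "\<not> d k" | "r \<le> k" by linarith
    then show "q (k + 1) (up M k y) = up ?X k (q k y)"
    proof cases
      case 2 then show ?thesis using start(2)[of y] k y by (simp add: q_def up_str)
    next
      \<comment> \<open>The arrow against the string: the functional at \<open>k + 1\<close> factors
        through the composite of \<open>up\<close> and \<open>dn\<close>, which is zero.\<close>
      case 4
      then have "\<phi>s (k + 1) (up M k y) = 0"
        using dns(2)[of k "up M k y"] is_rep_arrows[OF M, of k] lin_map_in[OF is_rep_arrows(1)[OF M], of k y] k y \<phi>0[of k]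
        by simp
      then show ?thesis using 4 by (simp add: q_def up_str)
    qed (use ups(2) y in \<open>auto simp: q_def up_str\<close>)
  next
    fix k y assume k: "k \<in> {1..<n}" and y: "y \<in> spc M (k + 1)"
    consider "k < a" | "k = a" | "a < k" "k < r" "\<not> d k" | "a < k" "k < r" "d k" | "k = r" | "r < k" by linarith
    then show "q k (dn M k y) = dn ?X k (q (k + 1) y)"
    proof cases
      case 4
      then have "\<phi>s k (dn M k y) = 0"
        using ups(2)[of k "dn M k y"] is_rep_arrows[OF M, of k] lin_map_in[OF is_rep_arrows(2)[OF M], of k y] k y \<phi>0[of "k + 1"]
        by simp
      then show ?thesis using 4 by (simp add: q_def dn_str)
    next
      \<comment> \<open>At the right end the arrow starts in the zero space at
        \<open>r + 1\<close>.\<close>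
      case 5
      then have "y = 0" using last[of "k + 1"] k y by auto
      then show ?thesis using 5 arrow0 k \<phi>0[of r] a by (simp add: q_def dn_str)
    qed (use dns(2) y in \<open>auto simp: q_def dn_str\<close>)
  qed
  have t: "is_hom n ?X M t"
    unfolding is_hom_def
  proof (intro conjI ballI)
    fix k assume k: "k \<in> {1..n}"
    then show "lin_map (spc ?X k) (spc M k) (t k)"
      using xs[of k] fvec.subspace_scale[OF sub[OF k]] fvec.subspace_0[OF sub[OF k]]
      by (auto simp: lin_map_def t_def fvec.scale_left_distrib)
  next
    fix k y assume k: "k \<in> {1..<n}" and y: "y \<in> spc ?X k"
    consider "k < a" | "k = a" | "a < k" "k < r" "d k" | "a < k" "k < r" "\<not> d k" | "k = r" | "r < k" by linarith
    then show "t (k + 1) (up ?X k y) = up M k (t k y)"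
    proof cases
      case 3 then show ?thesis using xs[of k] ups(1)[of k] k scale_arrow[of "xs k" k] by (simp add: t_def up_str)
    next
      case 4
      then have "up M k (xs k) = 0"
        using dns(1)[of k] is_rep_arrows(4)[OF M, of k] xs[of "k + 1"] k by fastforce
      then show ?thesis using 4 k xs[of k] scale_arrow[of "xs k" k] by (simp add: t_def up_str)
    next
      case 5
      then have "up M k (t k y) \<in> spc M (k + 1)"
        using k xs[of k] a fvec.subspace_scale[OF sub[of k]] lin_map_in[OF is_rep_arrows(1)[OF M, of k]]
        by (simp add: t_def)
      then show ?thesis using 5 last[of "k + 1"] k by (simp add: t_def up_str)
    qed (use arrow0 k in \<open>auto simp: t_def up_str\<close>)
  next
    fix k y assume k: "k \<in> {1..<n}" and y: "y \<in> spc ?X (k + 1)"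
    consider "k < a" | "k = a" | "a < k" "k < r" "\<not> d k" | "a < k" "k < r" "d k" | "r \<le> k" by linarith
    then show "t k (dn ?X k y) = dn M k (t (k + 1) y)"
    proof cases
      case 2 then show ?thesis using xs[of "k + 1"] start(1) a k scale_arrow'[of "xs (k + 1)" k] by (simp add: t_def dn_str)
    next
      case 3 then show ?thesis using xs[of "k + 1"] dns(1)[of k] k scale_arrow'[of "xs (k + 1)" k] by (simp add: t_def dn_str)
    next
      case 4
      then have "dn M k (xs (k + 1)) = 0"
        using ups(1)[of k] is_rep_arrows(3)[OF M, of k] xs[of k] k by fastforce
      then show ?thesis using 4 k xs[of "k + 1"] scale_arrow'[of "xs (k + 1)" k] by (simp add: t_def dn_str)
    qed (use arrow0 k in \<open>auto simp: t_def dn_str\<close>)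
  qed
  have "q k (t k y) = y" if "k \<in> {1..n}" "y \<in> spc ?X k" for k y
  proof (cases "a < k \<and> k \<le> r")
    case True
    then have "\<phi>s k (fscale (y 0) (xs k)) = y 0" using \<phi>s[of k] one[of k] xs[of k] by (simp add: lin_fun_def)
    then show ?thesis using True spc_str_coord[OF that(2)] by (simp add: q_def t_def)
  qed (use that in \<open>auto simp: q_def spc_str\<close>)
  then have "retract n M ?X q t" using q t by (simp add: retract_def)
  then show ?thesis using that a r(2) by blast
qed

section \<open>Strings in torsion classes\<close>

definition block :: "nat \<Rightarrow> nat \<Rightarrow> nat \<Rightarrow> (nat \<Rightarrow> 'k::field) \<Rightarrow> (nat \<Rightarrow> 'k)" where
  "block a b k x = (if a < k \<and> k \<le> b then x else 0)"

text \<open>Edge \<open>k\<close> joins the vertices \<open>k\<close> and \<open>k + 1\<close>, so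
  \<open>a\<close> and \<open>b\<close> are the boundary edges of the block. The map factors through
  the block, a quotient of the source since boundary arrows leave it there, and a submodule of the
  target since they enter it there.\<close>

lemma is_hom_block:
  assumes "i \<le> a" "b \<le> j" "i' \<le> a" "b \<le> j'" "\<And>k. a < k \<Longrightarrow> k < b \<Longrightarrow> d k = d' k"
    and "i < a \<Longrightarrow> \<not> d a" "b < j \<Longrightarrow> d b" "i' < a \<Longrightarrow> d' a" "b < j' \<Longrightarrow> \<not> d' b"
  shows "is_hom n (str i j d) (str i' j' d') (block a b)"
  unfolding is_hom_def
proof (intro conjI ballI)
  fix k assume "k \<in> {1..n}"
  show "lin_map (spc (str i j d) k) (spc (str i' j' d') k) (block a b k)"
    using assms(1-4) by (auto simp: lin_map_def block_def spc_str)
next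
  fix k x assume "k \<in> {1..<n}" "x \<in> spc (str i j d) k"
  consider "k < a" | "k = a" | "a < k" "k < b" | "k = b" | "b < k" by linarith
  then show "block a b (k + 1) (up (str i j d) k x) = up (str i' j' d') k (block a b k x)"
    by cases (use assms in \<open>auto simp: block_def up_str\<close>)
next
  fix k x assume "k \<in> {1..<n}" "x \<in> spc (str i j d) (k + 1)"
  consider "k < a" | "k = a" | "a < k" "k < b" | "k = b" | "b < k" by linarith
  then show "block a b k (dn (str i j d) k x) = dn (str i' j' d') k (block a b (k + 1) x)"
    by cases (use assms in \<open>auto simp: block_def dn_str\<close>)
qed

text \<open>Cutting off everything outside the block can fail to commute only at a boundary arrow
  that enters the block, and exactly there \<open>h\<close> is required to vanish outside.\<close>

lemma is_hom_block_comp: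
  assumes h: "is_hom n M (str i j d) h" and ab: "i \<le> a" "b \<le> j"
    and "\<And>x. i < a \<Longrightarrow> d a \<Longrightarrow> x \<in> spc M a \<Longrightarrow> h a x = 0"
    and "\<And>x. b < j \<Longrightarrow> \<not> d b \<Longrightarrow> x \<in> spc M (b + 1) \<Longrightarrow> h (b + 1) x = 0"
  shows "is_hom n M (str a b d) (\<lambda>k x. block a b k (h k x))"
  unfolding is_hom_def
proof (intro conjI ballI)
  fix k assume "k \<in> {1..n}"
  then show "lin_map (spc M k) (spc (str a b d) k) (\<lambda>x. block a b k (h k x))"
    using is_hom_lin[OF h, of k] ab by (auto simp: lin_map_def block_def spc_str)
next
  fix k x assume k: "k \<in> {1..<n}" and x: "x \<in> spc M k"
  have "h (k + 1) (up M k x) = up (str i j d) k (h k x)"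
    using h k x unfolding is_hom_def by blast
  then show "block a b (k + 1) (h (k + 1) (up M k x)) = up (str a b d) k (block a b k (h k x))"
    using assms(2-4) x by (cases "k = a") (auto simp: block_def up_str)
next
  fix k x assume k: "k \<in> {1..<n}" and x: "x \<in> spc M (k + 1)"
  have "h k (dn M k x) = dn (str i j d) k (h (k + 1) x)"
    using h k x unfolding is_hom_def by blast
  then show "block a b k (h k (dn M k x)) = dn (str a b d) k (block a b (k + 1) (h (k + 1) x))"
    using assms(2,3,5) x by (cases "k = b") (auto simp: block_def dn_str)
qed

lemma is_epi_block:
  assumes "i \<le> a" "b \<le> j" "i < a \<Longrightarrow> \<not> d a" "b < j \<Longrightarrow> d b"
  shows "is_epi n (str i j d :: 'k::field rep) (str a b d) (block a b)"
proof -
  have "block a b k ` spc (str i j d :: 'k rep) k = spc (str a b d) k" for k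
    using assms(1,2) by (auto simp: block_def spc_str)
  moreover have "is_hom n (str i j d :: 'k rep) (str a b d) (block a b)"
    by (rule is_hom_block) (use assms in auto)
  ultimately show ?thesis by (simp add: is_epi_def)
qed

lemma is_mono_block:
  assumes "i \<le> a" "b \<le> j" "i < a \<Longrightarrow> d a" "b < j \<Longrightarrow> \<not> d b"
  shows "is_mono n (str a b d :: 'k::field rep) (str i j d) (block a b)"
proof -
  have "inj_on (block a b k) (spc (str a b d :: 'k rep) k)" for k
    using assms(1,2) by (auto simp: block_def spc_str inj_on_def)
  moreover have "is_hom n (str a b d :: 'k rep) (str i j d) (block a b)"
    by (rule is_hom_block) (use assms in auto)
  ultimately show ?thesis by (simp add: is_mono_def)
qed

text \<open>The part that edge \<open>k\<close> points into is the submodule, the other part the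
  quotient.\<close>

lemma short_exact_str:
  assumes "i < k" "k < j"
  shows "d k \<Longrightarrow> short_exact n (str k j d :: 'k::field rep) (str i j d) (str i k d) (block k j) (block i k)"
    and "\<not> d k \<Longrightarrow> short_exact n (str i k d :: 'k rep) (str i j d) (str k j d) (block i k) (block k j)"
proof -
  have 1: "block k j m ` spc (str k j d :: 'k rep) m = {x \<in> spc (str i j d) m. block i k m x = 0}"
    "block i k m ` spc (str i k d :: 'k rep) m = {x \<in> spc (str i j d) m. block k j m x = 0}" for m
    using assms by (auto simp: block_def spc_str)
  show "d k \<Longrightarrow> short_exact n (str k j d :: 'k rep) (str i j d) (str i k d) (block k j) (block i k)"
    unfolding short_exact_def using is_mono_block[of i k j j d n] is_epi_block[of i i k j d n] assms 1 by auto
  show "\<not> d k \<Longrightarrow> short_exact n (str i k d :: 'k rep) (str i j d) (str k j d) (block i k) (block k j)"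
    unfolding short_exact_def using is_mono_block[of i i k j d n] is_epi_block[of i k j j d n] assms 1 by auto
qed

lemma str_quot:
  assumes "torsion_class n T" "str i j d \<in> T" "i \<le> a" "b \<le> j" "i < a \<Longrightarrow> \<not> d a" "b < j \<Longrightarrow> d b"
  shows "str a b d \<in> T"
  using torsion_class_quot[OF assms(1,2) is_rep_str is_epi_block] assms(3-6) by blast

lemma str_glue:
  assumes T: "torsion_class n T" and "str i k d \<in> T" "str k j d \<in> T" "i < k" "k < j"
  shows "str i j d \<in> T"
  using torsion_class_ext[OF T _ _ is_rep_str short_exact_str(1)[OF assms(4,5)]]
    torsion_class_ext[OF T _ _ is_rep_str short_exact_str(2)[OF assms(4,5)]] assms(2,3) by blast

text \<open>Cut at the edges where the two orientations differ: going from left to right,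
  the first segment that is bounded on the right in the favourable way will do.\<close>

lemma common_block:
  fixes d d' :: "nat \<Rightarrow> bool"
  assumes "i < j"
  obtains a b where "i \<le> a" "a < b" "b \<le> j" "\<And>k. a < k \<Longrightarrow> k < b \<Longrightarrow> d k = d' k"
    "i < a \<Longrightarrow> \<not> d a \<and> d' a" "b < j \<Longrightarrow> d b \<and> \<not> d' b"
proof -
  \<comment> \<open>The left end is \<open>i\<close> or an edge where the orientations differ in the
    way wanted there. Beyond the last such edge, the next disagreement must be of the opposite kind,
    as wanted at the right end; if there is none, the block ends at \<open>j\<close>.\<close>
  define S where "S = {k. i \<le> k \<and> k < j \<and> (k = i \<or> \<not> d k \<and> d' k)}"
  define a where "a = Max S"
  have S: "finite S" "i \<in> S" using assms by (auto simp: S_def)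
  have a: "a \<in> S" "\<And>k. k \<in> S \<Longrightarrow> k \<le> a" unfolding a_def using S Max_in Max_ge by blast+
  define R where "R = {k. a < k \<and> k \<le> j \<and> (k = j \<or> d k \<noteq> d' k)}"
  define b where "b = Min R"
  have R: "finite R" "j \<in> R" using a(1) by (auto simp: S_def R_def)
  have b: "b \<in> R" "\<And>k. k \<in> R \<Longrightarrow> b \<le> k" unfolding b_def using R Min_in Min_le by blast+
  show ?thesis
  proof
    show "i \<le> a" "a < b" "b \<le> j" "i < a \<Longrightarrow> \<not> d a \<and> d' a" using a b by (auto simp: S_def R_def)
    show "d k = d' k" if "a < k" "k < b" for k
      using b(2)[of k] that \<open>b \<le> j\<close> by (auto simp: R_def)
    show "d b \<and> \<not> d' b" if "b < j"
      using a(2)[of b] b(1) that \<open>i \<le> a\<close> by (auto simp: S_def R_def)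
  qed
qed

text \<open>The common block is a quotient of the first string and a submodule of the second. The
  map serves to contradict (P3).\<close>

lemma str_hom_same_support:
  assumes "i < j" "j \<le> n"
  obtains f k x where "is_hom n (str i j d) (str i j d') f" "k \<in> {1..n}" "x \<in> spc (str i j d) k" "f k x \<noteq> (0 :: nat \<Rightarrow> 'k::field)"
proof -
  obtain a b where ab: "i \<le> a" "a < b" "b \<le> j" "\<And>k. a < k \<Longrightarrow> k < b \<Longrightarrow> d k = d' k"
    "i < a \<Longrightarrow> \<not> d a \<and> d' a" "b < j \<Longrightarrow> d b \<and> \<not> d' b"
    using common_block[OF assms(1), of d d'] by metis
  have "is_hom n (str i j d :: 'k rep) (str i j d') (block a b)"
    by (rule is_hom_block) (use ab in auto)
  moreover have "(e0 :: nat \<Rightarrow> 'k) \<in> spc (str i j d) b" using ab e0_in_str[of i b j] by simp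
  moreover have "block a b b (e0 :: nat \<Rightarrow> 'k) \<noteq> 0" using ab by (simp add: block_def)
  moreover have "b \<in> {1..n}" using ab assms by auto
  ultimately show ?thesis using that by blast
qed

text \<open>Compare \<open>d\<close> with a string \<open>d'\<close> of \<open>T\<close> on the same
  interval. Their common block is a quotient of the latter, hence in \<open>T\<close>. The pieces of
  \<open>d\<close> to its left and right, if any, are quotients of \<open>d\<close>, so they are
  handled by induction and glued back.\<close>

lemma str_in_torsion_class:
  fixes T :: "'k::field rep set"
  assumes T: "torsion_class n T" and "i < j"
    and "\<And>a b. i \<le> a \<Longrightarrow> a < b \<Longrightarrow> b \<le> j \<Longrightarrow> (i < a \<Longrightarrow> \<not> d a) \<Longrightarrow> (b < j \<Longrightarrow> d b) \<Longrightarrow> \<exists>d'. str a b d' \<in> T"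
  shows "str i j d \<in> T"
  using assms(2,3)
proof (induction "j - i" arbitrary: i j rule: less_induct)
  case less
  obtain d' where d': "str i j d' \<in> T" using less.prems by blast
  obtain a b where ab: "i \<le> a" "a < b" "b \<le> j" "\<And>k. a < k \<Longrightarrow> k < b \<Longrightarrow> d' k = d k"
    "i < a \<Longrightarrow> \<not> d' a \<and> d a" "b < j \<Longrightarrow> d' b \<and> \<not> d b"
    using common_block[OF less.prems(1), of d' d] by metis
  have "str a b d' \<in> T" by (rule str_quot[OF T d']) (use ab in auto)
  moreover have "(str a b d' :: 'k rep) = str a b d" using ab(4) by (rule str_cong)
  ultimately have mid: "str a b d \<in> T" by simp
  \<comment> \<open>Edge \<open>a\<close> of \<open>d\<close> points from this piece into the block,
    so quotient intervals of the piece are quotient intervals of the whole string and the hypothesis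
    is inherited.\<close>
  have left: "str i a d \<in> T" if "i < a"
  proof (rule less.hyps)
    show "\<exists>d'. str a' b' d' \<in> T" if "i \<le> a'" "a' < b'" "b' \<le> a" "i < a' \<Longrightarrow> \<not> d a'" "b' < a \<Longrightarrow> d b'" for a' b'
      using less.prems(2)[of a' b'] that ab \<open>i < a\<close> by (cases "b' = a") auto
  qed (use ab that in auto)
  have right: "str b j d \<in> T" if "b < j"
  proof (rule less.hyps)
    show "\<exists>d'. str a' b' d' \<in> T" if "b \<le> a'" "a' < b'" "b' \<le> j" "b < a' \<Longrightarrow> \<not> d a'" "b' < j \<Longrightarrow> d b'" for a' b'
      using less.prems(2)[of a' b'] that ab \<open>b < j\<close> by (cases "a' = b") auto
  qed (use ab that in auto)
  have "str i b d \<in> T"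
    using mid left str_glue[OF T, of i a d b] ab by (cases "i = a") auto
  then show ?case
    using right str_glue[OF T, of i b d j] ab by (cases "b = j") auto
qed

section \<open>Torsion classes and biclosed sets\<close>

text \<open>A version of \<open>inv_tors\<close> that speaks only of strings;
  \<open>inv_tors_eq_str_invs\<close> identifies the two for torsion classes.\<close>

definition str_invs :: "nat \<Rightarrow> 'k::field rep set \<Rightarrow> (nat \<times> nat) set" where
  "str_invs n T = {(i, j). i < j \<and> j \<le> n \<and> (\<exists>d. str i j d \<in> T)}"

definition tors_of :: "nat \<Rightarrow> (nat \<times> nat) set \<Rightarrow> 'k::field rep set" where
  "tors_of n A = {M. is_rep n M \<and> (\<forall>i j d f. i < j \<and> j \<le> n \<and> is_epi n M (str i j d) f \<longrightarrow> (i, j) \<in> A)}"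

text \<open>The last clause, called coclosedness below, is transitivity of the complement among the
  pairs \<open>i < j\<close>.\<close>

definition biclosed :: "nat \<Rightarrow> (nat \<times> nat) set \<Rightarrow> bool" where
  "biclosed n A \<longleftrightarrow> (\<forall>i j. (i, j) \<in> A \<longrightarrow> i < j \<and> j \<le> n) \<and> trans A \<and>
     (\<forall>i k j. i < k \<and> k < j \<and> (i, j) \<in> A \<longrightarrow> (i, k) \<in> A \<or> (k, j) \<in> A)"

lemma biclosed_str_invs:
  fixes T :: "'k::field rep set"
  assumes T: "torsion_class n T"
  shows "biclosed n (str_invs n T)"
proof -
  have "(i, j) \<in> str_invs n T" if ik: "(i, k) \<in> str_invs n T" "(k, j) \<in> str_invs n T" for i k j
  proof -
    obtain d d' where d: "i < k" "k < j" "j \<le> n" "str i k d \<in> T" "str k j d' \<in> T"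
      using ik unfolding str_invs_def by blast
    \<comment> \<open>Edge \<open>k\<close> takes its orientation from \<open>d'\<close>, but either
      choice gives an extension of the two strings.\<close>
    let ?d = "\<lambda>m. if m < k then d m else d' m"
    have "(str i k ?d :: 'k rep) = str i k d" "(str k j ?d :: 'k rep) = str k j d'" by (auto intro!: str_cong)
    then have "str i j ?d \<in> T" using str_glue[OF T, of i k ?d j] d by metis
    then show ?thesis using d by (auto simp: str_invs_def)
  qed
  moreover have "(i, k) \<in> str_invs n T \<or> (k, j) \<in> str_invs n T" if "i < k" "k < j" "(i, j) \<in> str_invs n T" for i k j
  proof -
    obtain d where "j \<le> n" "str i j d \<in> T" using \<open>(i, j) \<in> str_invs n T\<close> by (auto simp: str_invs_def)
    moreover have "str i k d \<in> T" if "d k"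
      by (rule str_quot[OF T \<open>str i j d \<in> T\<close>]) (use that \<open>i < k\<close> \<open>k < j\<close> in auto)
    moreover have "str k j d \<in> T" if "\<not> d k"
      by (rule str_quot[OF T \<open>str i j d \<in> T\<close>]) (use that \<open>i < k\<close> \<open>k < j\<close> in auto)
    ultimately show ?thesis using that by (cases "d k") (auto simp: str_invs_def)
  qed
  moreover have "i < j \<and> j \<le> n" if "(i, j) \<in> str_invs n T" for i j
    using that by (simp add: str_invs_def)
  ultimately show ?thesis
    unfolding biclosed_def trans_def by blast
qed

text \<open>The vertices in (i, j] fall into maximal runs of constant colour; the hypothesis
  \<open>blk\<close> covers each run (a, b], and transitivity chains the pairs.\<close>

lemma trans_colour_blocks:
  fixes u :: "nat \<Rightarrow> bool"
  assumes "i < j" "trans A"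
    and blk: "\<And>a b. i \<le> a \<Longrightarrow> a < b \<Longrightarrow> b \<le> j \<Longrightarrow> (\<And>k. a < k \<Longrightarrow> k \<le> b \<Longrightarrow> u k = u b) \<Longrightarrow>
      (i < a \<Longrightarrow> u a \<noteq> u b) \<Longrightarrow> (b < j \<Longrightarrow> u b \<noteq> u (b + 1)) \<Longrightarrow> (a, b) \<in> A"
  shows "(i, j) \<in> A"
proof -
  have "(i, b) \<in> A" if "i < b" "b \<le> j" "b < j \<Longrightarrow> u b \<noteq> u (b + 1)" for b
    using that
  proof (induction b rule: less_induct)
    case (less b)
    \<comment> \<open>The colour changes before \<open>b\<close>; \<open>i\<close> is included so
      that the maximum also exists when the run ending at \<open>b\<close> is the leftmost
      one.\<close>
    define S where "S = {k. i \<le> k \<and> k < b \<and> (k = i \<or> u k \<noteq> u (k + 1))}"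
    define a where "a = Max S"
    have S: "finite S" "i \<in> S" using less.prems by (auto simp: S_def)
    have a: "a \<in> S" "\<And>k. k \<in> S \<Longrightarrow> k \<le> a" unfolding a_def using S Max_in Max_ge by blast+
    have const: "u k = u b" if "k \<le> b" "a < k" for k
      using that(1,2)
    proof (induction k rule: inc_induct)
      case (step k)
      then show ?case using a(1) a(2)[of k] by (auto simp: S_def)
    qed simp
    have ia: "i \<le> a" "a < b" using a(1) by (auto simp: S_def)
    have change: "u a \<noteq> u (a + 1)" if "i < a" using a(1) that by (auto simp: S_def)
    have "(a, b) \<in> A"
    proof (rule blk[OF ia less.prems(2)])
      show "u k = u b" if "a < k" "k \<le> b" for k using const that by blast
      show "u a \<noteq> u b" if "i < a" using change[OF that] const[of "a + 1"] ia by simp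
      show "u b \<noteq> u (b + 1)" if "b < j" using less.prems(3)[OF that] .
    qed
    moreover have "(i, a) \<in> A" if "i < a"
      by (rule less.IH[OF ia(2) that]) (use ia less.prems(2) change[OF that] in auto)
    ultimately show ?case using ia(1) \<open>trans A\<close> by (cases "a = i") (auto dest: transD)
  qed
  then show ?thesis using assms(1) by simp
qed

text \<open>The universal property of a cokernel. \<open>h'\<close> is evaluated at chosen
  preimages; two preimages differ by an element of the image of \<open>f\<close>, which
  \<open>h\<close> kills.\<close>

lemma short_exact_factor:
  assumes C: "is_rep n C" and B: "is_rep n B" and ex: "short_exact n A B C f g" and h: "is_hom n B X h"
    and 0: "\<And>k x. k \<in> {1..n} \<Longrightarrow> x \<in> spc A k \<Longrightarrow> h k (f k x) = 0"
  obtains h' where "is_hom n C X h'" "\<And>k x. k \<in> {1..n} \<Longrightarrow> x \<in> spc B k \<Longrightarrow> h' k (g k x) = h k x"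
proof -
  have g: "is_hom n B C g" and sur: "\<And>k. k \<in> {1..n} \<Longrightarrow> g k ` spc B k = spc C k"
    and ker: "\<And>k. k \<in> {1..n} \<Longrightarrow> f k ` spc A k = {x \<in> spc B k. g k x = 0}"
    using ex unfolding short_exact_def is_epi_def by auto
  define h' where "h' = (\<lambda>k z. h k (SOME x. x \<in> spc B k \<and> g k x = z))"
  have h': "h' k (g k x) = h k x" if k: "k \<in> {1..n}" and x: "x \<in> spc B k" for k x
  proof -
    define y where "y = (SOME y. y \<in> spc B k \<and> g k y = g k x)"
    have y: "y \<in> spc B k" "g k y = g k x" unfolding y_def using someI[of "\<lambda>y. y \<in> spc B k \<and> g k y = g k x" x] x by blast+
    note S = is_rep_subspace[OF B k]
    have "g k (y - x) = 0" using lin_map_diff[OF is_hom_lin[OF g k] S y(1) x] y(2) by simp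
    then have "y - x \<in> f k ` spc A k" using ker[OF k] fvec.subspace_diff[OF S y(1) x] by blast
    then obtain w where "y - x = f k w" "w \<in> spc A k" by (rule imageE)
    then have "h k (y - x) = 0" using 0[OF k] by simp
    then have "h k y = h k x" using lin_map_diff[OF is_hom_lin[OF h k] S y(1) x] by simp
    then show ?thesis by (simp add: h'_def y_def)
  qed
  have ex: "\<exists>x\<in>spc B k. z = g k x" if "k \<in> {1..n}" "z \<in> spc C k" for k z using sur that by blast
  have "is_hom n C X h'"
    unfolding is_hom_def
  proof (intro conjI ballI)
    fix k assume k: "k \<in> {1..n}"
    note S = is_rep_subspace[OF B k]
    have gl: "lin_map (spc B k) (spc C k) (g k)" and hl: "lin_map (spc B k) (spc X k) (h k)"
      using is_hom_lin g h k by blast+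
    show "lin_map (spc C k) (spc X k) (h' k)"
      unfolding lin_map_def
    proof (intro conjI ballI allI)
      show "h' k ` spc C k \<subseteq> spc X k" using ex[OF k] h'[OF k] is_hom_in[OF h k] by force
    next
      fix y z assume "y \<in> spc C k" "z \<in> spc C k"
      then obtain a b where ab: "a \<in> spc B k" "b \<in> spc B k" "y = g k a" "z = g k b" using ex[OF k] by blast
      then have "h' k (y + z) = h' k (g k (a + b))" using gl unfolding lin_map_def by simp
      also have "\<dots> = h k (a + b)" using h'[OF k fvec.subspace_add[OF S ab(1,2)]] .
      finally show "h' k (y + z) = h' k y + h' k z" using h'[OF k] ab hl unfolding lin_map_def by simp
    next
      fix c y assume "y \<in> spc C k"
      then obtain a where ab: "a \<in> spc B k" "y = g k a" using ex[OF k] by blast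
      then have "h' k (fscale c y) = h' k (g k (fscale c a))" using gl unfolding lin_map_def by simp
      also have "\<dots> = h k (fscale c a)" using h'[OF k fvec.subspace_scale[OF S ab(1)]] .
      finally show "h' k (fscale c y) = fscale c (h' k y)" using h'[OF k] ab hl unfolding lin_map_def by simp
    qed
  next
    fix k z assume k: "k \<in> {1..<n}" and "z \<in> spc C k"
    then obtain x where x: "x \<in> spc B k" "z = g k x" using ex[of k z] by auto
    have "h' (k + 1) (up C k z) = h' (k + 1) (g (k + 1) (up B k x))"
      using g k x unfolding is_hom_def by simp
    also have "\<dots> = h (k + 1) (up B k x)"
      using h'[of "k + 1"] lin_map_in[OF is_rep_arrows(1)[OF B]] k x by simp
    also have "\<dots> = up X k (h' k z)" using h k x h'[of k x] unfolding is_hom_def by simp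
    finally show "h' (k + 1) (up C k z) = up X k (h' k z)" .
  next
    fix k z assume k: "k \<in> {1..<n}" and "z \<in> spc C (k + 1)"
    then obtain x where x: "x \<in> spc B (k + 1)" "z = g (k + 1) x" using ex[of "k + 1" z] by auto
    have "h' k (dn C k z) = h' k (g k (dn B k x))"
      using g k x unfolding is_hom_def by simp
    also have "\<dots> = h k (dn B k x)"
      using h'[of k] lin_map_in[OF is_rep_arrows(2)[OF B]] k x by simp
    also have "\<dots> = dn X k (h' (k + 1) z)" using h k x h'[of "k + 1" x] unfolding is_hom_def by simp
    finally show "h' k (dn C k z) = dn X k (h' (k + 1) z)" .
  qed
  then show ?thesis using that h' by blast
qed

lemma line_dichotomy:
  assumes "fvec.subspace U" "U \<subseteq> range (\<lambda>c. fscale c (e0 :: nat \<Rightarrow> 'k::field))" "U \<noteq> {0}"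
  shows "U = range (\<lambda>c. fscale c e0)"
proof -
  have "0 \<in> U" using assms(1) fvec.subspace_0 by blast
  then obtain x where x: "x \<in> U" "x \<noteq> 0" using assms(3) by blast
  then obtain c where "x = fscale c e0" using assms(2) by blast
  then have c: "fscale c e0 \<in> U" "c \<noteq> 0" using x by auto
  then have "fscale (b / c) (fscale c e0) \<in> U" for b
    using fvec.subspace_scale[OF assms(1)] by blast
  then have "fscale b e0 \<in> U" for b using c(2) by (simp add: fvec.scale_scale)
  then show ?thesis using assms(2) by blast
qed

section \<open>Modules whose string quotients have their pairs in a given set\<close>

lemma tors_ofD:
  "M \<in> tors_of n A \<Longrightarrow> is_epi n M (str i j d) f \<Longrightarrow> i < j \<Longrightarrow> j \<le> n \<Longrightarrow> (i, j) \<in> A"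
  unfolding tors_of_def by blast

text \<open>Closure under extensions is the point. For a string quotient of \<open>B\<close>,
  consider the image of \<open>X\<close> in the string. A run of vertices where this image is
  nonzero is a quotient of \<open>X\<close>, and a run where it vanishes is a quotient of
  \<open>C\<close>. Transitivity of \<open>A\<close> joins the runs.\<close>

lemma torsion_class_tors_of:
  assumes tr: "trans A"
  shows "torsion_class n (tors_of n A :: 'k::field rep set)"
proof (rule torsion_classI)
  \<comment> \<open>The zero module witnesses nonemptiness: it has no string quotient, as a string
    is nonzero at its last vertex.\<close>
  have "\<not> is_epi n (str 0 0 (\<lambda>_. True)) (str i j d :: 'k rep) f" if "i < j" "j \<le> n" for i j d f
  proof
    assume e: "is_epi n (str 0 0 (\<lambda>_. True)) (str i j d :: 'k rep) f"
    then have "f j ` {0} = spc (str i j d) j" using that by (auto simp: is_epi_def spc_str)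
    moreover have "f j 0 = 0" using e is_hom_zero[OF is_rep_str, of n 0 0 _ _ f j] that unfolding is_epi_def by auto
    ultimately show False using spc_str_eq_0_iff[of i j d j] that by auto
  qed
  then have "(str 0 0 (\<lambda>_. True) :: 'k rep) \<in> tors_of n A"
    unfolding tors_of_def mem_Collect_eq using is_rep_str by (intro conjI allI impI) blast+
  then show "(tors_of n A :: 'k rep set) \<noteq> {}" by blast
next
  show "is_rep n M" if "M \<in> tors_of n A" for M using that by (simp add: tors_of_def)
next
  show "N \<in> tors_of n A" if "M \<in> tors_of n A" "is_rep n N" "is_epi n M N f" for M N f
    using that is_epi_comp[OF that(3)] unfolding tors_of_def by blast
next
  fix X B C :: "'k rep" and f g
  assume X: "X \<in> tors_of n A" and C: "C \<in> tors_of n A" and B: "is_rep n B" and ex: "short_exact n X B C f g"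
  have reps: "is_rep n X" "is_rep n C" using X C by (auto simp: tors_of_def)
  have f: "is_hom n X B f" using ex by (auto simp: short_exact_def is_mono_def)
  show "B \<in> tors_of n A"
    unfolding tors_of_def
  proof (intro CollectI conjI allI impI B)
    fix i j d q assume *: "i < j \<and> j \<le> n \<and> is_epi n B (str i j d :: 'k rep) q"
    let ?S = "str i j d :: 'k rep"
    have q: "is_hom n B ?S q" and qs: "\<And>k. k \<in> {1..n} \<Longrightarrow> q k ` spc B k = spc ?S k"
      using * by (auto simp: is_epi_def)
    define h where "h = (\<lambda>k x. q k (f k x))"
    have h: "is_hom n X ?S h" unfolding h_def using is_hom_comp[OF f q] .
    \<comment> \<open>The colour says whether the image of \<open>X\<close> at a vertex of the
      string is the whole line or zero.\<close>
    define u where "u k \<longleftrightarrow> h k ` spc X k \<noteq> {0}" for k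
    have line: "h k ` spc X k = spc ?S k" if "i < k" "k \<le> j" "u k" for k
    proof -
      have k: "k \<in> {1..n}" using that * by auto
      have "fvec.subspace (h k ` spc X k)"
        using lin_map_subspaces(2)[OF is_hom_lin[OF h k] is_rep_subspace[OF reps(1) k] is_rep_subspace[OF reps(1) k]] by simp
      moreover have "h k ` spc X k \<subseteq> spc ?S k" using is_hom_in[OF h k] by blast
      ultimately show ?thesis
        using line_dichotomy[of "h k ` spc X k"] that by (simp add: u_def spc_str)
    qed
    have zero: "h k x = 0" if "\<not> u k" "x \<in> spc X k" for k x using that by (auto simp: u_def)
    show "(i, j) \<in> A"
    proof (rule trans_colour_blocks[of i j A u])
      fix a b
      assume ab: "i \<le> a" "a < b" "b \<le> j" and const: "\<And>k. a < k \<Longrightarrow> k \<le> b \<Longrightarrow> u k = u b"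
        and ua: "i < a \<Longrightarrow> u a \<noteq> u b" and ub: "b < j \<Longrightarrow> u b \<noteq> u (b + 1)"
      show "(a, b) \<in> A"
      proof (cases "u b")
        case True
        \<comment> \<open>At the neighbours of this run the image of \<open>X\<close> is zero, so no
          arrow carries it into the block.\<close>
        have "is_hom n X (str a b d) (\<lambda>k x. block a b k (h k x))"
          by (rule is_hom_block_comp[OF h ab(1,3)]) (use ua ub True zero in auto)
        moreover have "(\<lambda>x. block a b k (h k x)) ` spc X k = spc (str a b d) k" if "k \<in> {1..n}" for k
        proof (cases "a < k \<and> k \<le> b")
          case True
          then have "h k ` spc X k = spc ?S k" using line[of k] const[of k] \<open>u b\<close> ab by simp
          then show ?thesis using True ab by (simp add: block_def spc_str)
        next
          case False
          then show ?thesis using fvec.subspace_0[OF is_rep_subspace[OF reps(1) that]]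
            by (auto simp: block_def spc_str)
        qed
        ultimately have "is_epi n X (str a b d) (\<lambda>k x. block a b k (h k x))" by (simp add: is_epi_def)
        then show ?thesis using tors_ofD[OF X] ab * by auto
      next
        case False
        \<comment> \<open>In the neighbouring run the image of \<open>X\<close> is the whole line,
          and an arrow entering the block would carry it inside. Hence the boundary arrows leave the
          block, which makes it a quotient of the string.\<close>
        have da: "\<not> d a" if "i < a"
        proof
          assume "d a"
          have a: "a \<in> {1..<n}" using that ab * by auto
          have "e0 \<in> h a ` spc X a" using line[of a] e0_in_str[of i a j d] that ua False ab by auto
          then obtain x where x: "x \<in> spc X a" "h a x = e0" by auto
          then have "h (a + 1) (up X a x) = e0"
            using h a \<open>d a\<close> that ab unfolding is_hom_def by (simp add: up_str)
          moreover have "up X a x \<in> spc X (a + 1)"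
            using lin_map_in[OF is_rep_arrows(1)[OF reps(1)] x(1)] a by simp
          ultimately show False using zero[of "a + 1"] const[of "a + 1"] False ab by auto
        qed
        have db: "d b" if "b < j"
        proof (rule ccontr)
          assume "\<not> d b"
          have b: "b \<in> {1..<n}" using that ab * by auto
          have "e0 \<in> h (b + 1) ` spc X (b + 1)" using line[of "b + 1"] e0_in_str[of i "b + 1" j d] that ub False ab by auto
          then obtain x where x: "x \<in> spc X (b + 1)" "h (b + 1) x = e0" by auto
          then have "h b (dn X b x) = e0"
            using h b \<open>\<not> d b\<close> that ab unfolding is_hom_def by (simp add: dn_str)
          moreover have "dn X b x \<in> spc X b"
            using lin_map_in[OF is_rep_arrows(2)[OF reps(1)] x(1)] b by simp
          ultimately show False using zero[of b] False by auto
        qed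
        let ?p = "\<lambda>k x. block a b k (q k x)"
        have p: "is_epi n B (str a b d) ?p"
          by (rule is_epi_comp[of n B ?S q]) (use * da db ab in \<open>auto intro!: is_epi_block\<close>)
        have ph: "is_hom n B (str a b d) ?p" using p by (simp add: is_epi_def)
        have p0: "?p k (f k x) = 0" if "k \<in> {1..n}" "x \<in> spc X k" for k x
          using zero[of k x] const[of k] that False by (auto simp: block_def h_def)
        obtain p' where p': "is_hom n C (str a b d) p'" "\<And>k x. k \<in> {1..n} \<Longrightarrow> x \<in> spc B k \<Longrightarrow> p' k (g k x) = ?p k x"
          by (rule short_exact_factor[OF reps(2) B ex ph p0]) (assumption | rule that | simp)+
        have "p' k ` spc C k = spc (str a b d) k" if k: "k \<in> {1..n}" for k
        proof -
          have "spc C k = g k ` spc B k" using ex k by (auto simp: short_exact_def is_epi_def)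
          then have "p' k ` spc C k = ?p k ` spc B k" using p'(2)[OF k] by (auto simp: image_image)
          then show ?thesis using p k by (simp add: is_epi_def)
        qed
        then have "is_epi n C (str a b d) p'" using p'(1) by (simp add: is_epi_def)
        then show ?thesis using tors_ofD[OF C] ab * by auto
      qed
    qed (use * tr in auto)
  qed
qed

text \<open>Converse to \<open>is_epi_block\<close>. If an arrow entered the interval, a preimage of
  \<open>e0\<close> at the boundary vertex would itself come through that arrow, which is zero in
  the target.\<close>

lemma is_epi_str_str:
  assumes e: "is_epi n (str i j d) (str a b d' :: 'k::field rep) f" and ab: "a < b" "b \<le> n" and jn: "j \<le> n"
  shows "i \<le> a" "b \<le> j" "i < a \<Longrightarrow> \<not> d a" "b < j \<Longrightarrow> d b"
proof -
  have f: "is_hom n (str i j d) (str a b d') f" and sur: "\<And>k. k \<in> {1..n} \<Longrightarrow> f k ` spc (str i j d) k = spc (str a b d') k"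
    using e by (auto simp: is_epi_def)
  have f0: "f k 0 = 0" if "k \<in> {1..n}" for k using is_hom_zero[OF is_rep_str f that] .
  have inc: "i < k \<and> k \<le> j" if "a < k" "k \<le> b" for k
  proof (rule ccontr)
    assume "\<not> ?thesis"
    then have "spc (str i j d) k = ({0} :: (nat \<Rightarrow> 'k) set)" by (simp only: spc_str if_False)
    then have "spc (str a b d' :: 'k rep) k = {0}" using sur[of k] f0[of k] that ab by auto
    then show False using spc_str_eq_0_iff[of a b d' k] that by blast
  qed
  show "i \<le> a" "b \<le> j" using ab inc[of "a + 1"] inc[of b] by simp_all
  have pre: "\<exists>x\<in>spc (str i j d) k. f k x = e0" if "a < k" "k \<le> b" for k
  proof -
    have "k \<in> {1..n}" using that ab by simp
    then have "e0 \<in> f k ` spc (str i j d) k" using sur e0_in_str[OF that] by metis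
    then show ?thesis by (metis imageE)
  qed
  show "\<not> d a" if "i < a"
  proof
    assume "d a"
    obtain x where x: "x \<in> spc (str i j d) (a + 1)" "f (a + 1) x = e0" using pre[of "a + 1"] ab by auto
    have "x \<in> spc (str i j d) a" using x(1) that inc[of "a + 1"] ab by (auto simp: spc_str)
    then have "f (a + 1) (up (str i j d) a x) = up (str a b d') a (f a x)"
      using f that ab unfolding is_hom_def by simp
    then show False using x(2) \<open>d a\<close> that inc[of "a + 1"] ab by (simp add: up_str)
  qed
  show "d b" if "b < j"
  proof (rule ccontr)
    assume "\<not> d b"
    obtain x where x: "x \<in> spc (str i j d) b" "f b x = e0" using pre[of b] ab by auto
    have xb: "x \<in> spc (str i j d) (b + 1)" using x(1) that inc[of b] ab by (auto simp: spc_str)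
    have "f b (dn (str i j d) b x) = dn (str a b d') b (f (b + 1) x)"
      using f xb ab that jn unfolding is_hom_def by simp
    then show False using x(2) \<open>\<not> d b\<close> that inc[of b] ab by (simp add: dn_str)
  qed
qed

lemma str_invs_tors_of:
  assumes A: "biclosed n A"
  shows "str_invs n (tors_of n A :: 'k::field rep set) = A"
proof (intro equalityI subrelI)
  fix i j assume "(i, j) \<in> str_invs n (tors_of n A :: 'k rep set)"
  then obtain d where d: "i < j" "j \<le> n" "(str i j d :: 'k rep) \<in> tors_of n A"
    unfolding str_invs_def by blast
  have "is_epi n (str i j d :: 'k rep) (str i j d) (block i j)"
    by (rule is_epi_block) auto
  then show "(i, j) \<in> A" using tors_ofD[OF d(3)] d by blast
next
  fix i j assume ij: "(i, j) \<in> A"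
  have bij: "i < j" "j \<le> n" and tr: "trans A"
    and co: "\<And>i k j. i < k \<Longrightarrow> k < j \<Longrightarrow> (i, j) \<in> A \<Longrightarrow> (i, k) \<in> A \<or> (k, j) \<in> A"
    using A ij unfolding biclosed_def by blast+
  \<comment> \<open>The orientation is read off \<open>A\<close>: a quotient interval (a, b] has
    \<open>(i, b)\<close> in \<open>A\<close> and, unless \<open>a = i\<close>,
    \<open>(i, a)\<close> outside \<open>A\<close>, so coclosedness puts \<open>(a, b)\<close> in
    \<open>A\<close>.\<close>
  define d where "d = (\<lambda>k. (i, k) \<in> A)"
  have "(a, b) \<in> A" if "a < b" "b \<le> n" and e: "is_epi n (str i j d :: 'k rep) (str a b d') f" for a b d' f
  proof -
    note ab = is_epi_str_str[OF e that(1,2) bij(2)]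
    have "(i, b) \<in> A" using ab(2,4) ij by (cases "b = j") (auto simp: d_def)
    then show ?thesis using ab(1,3) co[of i a b] that(1) by (cases "a = i") (auto simp: d_def)
  qed
  then have "(str i j d :: 'k rep) \<in> tors_of n A"
    unfolding tors_of_def using is_rep_str by blast
  then show "(i, j) \<in> str_invs n (tors_of n A :: 'k rep set)" using bij unfolding str_invs_def by blast
qed

text \<open>For the harder inclusion, by induction on the total dimension, a string is split off.
  Its string quotients are quotients of \<open>M\<close>, so \<open>str_in_torsion_class\<close>
  puts it in \<open>T\<close>; one extension reassembles \<open>M\<close>.\<close>

lemma tors_of_str_invs:
  fixes T :: "'k::field rep set"
  assumes T: "torsion_class n T"
  shows "tors_of n (str_invs n T) = T"
proof (intro equalityI subsetI)
  fix M assume M: "M \<in> T"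
  have "(i, j) \<in> str_invs n T" if "i < j" "j \<le> n" "is_epi n M (str i j d) f" for i j d f
    using torsion_class_quot[OF T M is_rep_str that(3)] that unfolding str_invs_def by blast
  then show "M \<in> tors_of n (str_invs n T)"
    using torsion_class_rep[OF T M] unfolding tors_of_def by blast
next
  fix M :: "'k rep" assume "M \<in> tors_of n (str_invs n T)"
  then show "M \<in> T"
  proof (induction "length_rep n M" arbitrary: M rule: less_induct)
    case less
    have rep: "is_rep n M" using less.prems by (simp add: tors_of_def)
    show ?case
    proof (cases "is_zero n M")
      case True
      then show ?thesis using torsion_class_zero[OF T rep] by blast
    next
      case False
      then obtain a r d q s where ar: "a < r" "r \<le> n" and ret: "retract n M (str a r d) q s"
        using string_retract[OF rep] by metis
      have q: "is_epi n M (str a r d) q" using retract_epi[OF ret] .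
      then have hq: "is_hom n M (str a r d) q" by (simp add: is_epi_def)
      have S: "str a r d \<in> T"
      proof (rule str_in_torsion_class[OF T ar(1)])
        fix a' b' assume *: "a \<le> a'" "a' < b'" "b' \<le> r" "a < a' \<Longrightarrow> \<not> d a'" "b' < r \<Longrightarrow> d b'"
        have "is_epi n M (str a' b' d) (\<lambda>k x. block a' b' k (q k x))"
          by (rule is_epi_comp[OF q is_epi_block]) (use * in auto)
        then have "(a', b') \<in> str_invs n T" using tors_ofD[OF less.prems] * ar by auto
        then show "\<exists>d'. str a' b' d' \<in> T" unfolding str_invs_def by blast
      qed
      let ?K = "restr M (kern M q)"
      have sub: "is_sub n (kern M q) M" using is_sub_kern[OF rep is_rep_str hq] .
      have "kern M q r \<noteq> spc M r"
      proof
        assume eq: "kern M q r = spc M r"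
        have r: "r \<in> {1..n}" using ar by auto
        have "q r ` spc M r = (\<lambda>_. 0) ` spc M r"
          by (rule image_cong) (use eq in \<open>auto simp: kern_def\<close>)
        moreover have "0 \<in> spc M r" using fvec.subspace_0[OF is_rep_subspace[OF rep r]] .
        ultimately have "q r ` spc M r = {0}" by (metis image_constant)
        then have "spc (str a r d :: 'k rep) r = {0}" using q r by (simp add: is_epi_def)
        then show False using spc_str_eq_0_iff[of a r d r] ar by blast
      qed
      then have less_len: "length_rep n ?K < length_rep n M"
        using length_rep_sub_less[OF rep sub, of r] ar by simp
      have K: "is_rep n ?K" using is_rep_restr[OF rep sub] .
      \<comment> \<open>Since \<open>q\<close> splits, the kernel is a quotient of \<open>M\<close>
        and inherits the condition on string quotients.\<close>
      have "?K \<in> tors_of n (str_invs n T)"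
        using torsion_class_quot[OF torsion_class_tors_of less.prems K retract_projection(1)[OF rep is_rep_str ret]]
          biclosed_str_invs[OF T] unfolding biclosed_def by blast
      then have "?K \<in> T" using less.hyps[OF less_len] by blast
      then show ?thesis
        using torsion_class_ext[OF T _ S rep short_exact_kern[OF rep is_rep_str q]] by blast
    qed
  qed
qed

section \<open>Indecomposable modules\<close>

lemma support_eq_if_kern_zero:
  assumes "is_rep n M" "is_rep n N" "is_epi n M N f" "\<And>k. k \<in> {1..n} \<Longrightarrow> kern M f k = {0}"
  shows "support n M = support n N"
proof -
  have "spc M k = {0} \<longleftrightarrow> spc N k = {0}" if k: "k \<in> {1..n}" for k
  proof
    have f: "is_hom n M N f" "f k ` spc M k = spc N k" using assms(3) k by (auto simp: is_epi_def)
    show "spc N k = {0}" if "spc M k = {0}" using f(2) is_hom_zero[OF assms(1) f(1) k] that by auto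
    show "spc M k = {0}" if "spc N k = {0}" using assms(4)[OF k] f(2) that by (auto simp: kern_def)
  qed
  then show ?thesis by (auto simp: support_def)
qed

text \<open>Each vertex of the interval carries a line, which lies in exactly one of two
  complementary submodules; the identity along each edge puts neighbours in the same one. So the
  other is zero.\<close>

lemma indecomposable_str:
  assumes "i < j" "j \<le> n"
  shows "indecomposable n (str i j d :: 'k::field rep)"
  unfolding indecomposable_def
proof (intro conjI is_rep_str notI)
  show False if "is_zero n (str i j d :: 'k rep)"
    using that support_str[OF assms(2), of i d, where 'a='k] assms by (auto simp: is_zero_def)
next
  let ?S = "str i j d :: 'k rep"
  have key: False
    if U: "is_sub n U ?S" "\<not> is_zero n (restr ?S U)" and W: "is_sub n W ?S" "\<not> is_zero n (restr ?S W)"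
      and dir: "\<forall>k\<in>{1..n}. U k \<inter> W k = {0} \<and> spc ?S k = {x + y | x y. x \<in> U k \<and> y \<in> W k}" for U W
  proof -
  have inS: "k \<in> {1..n}" if "i < k" "k \<le> j" for k using that assms by auto
  have line: "V k = {0} \<or> e0 \<in> V k" if V: "is_sub n V ?S" and k: "i < k" "k \<le> j" for V k
  proof -
    have "fvec.subspace (V k)" "V k \<subseteq> range (\<lambda>c. fscale c e0)"
      using is_subD(1,2)[OF V inS[OF k]] k by (simp_all add: spc_str)
    then have "V k = {0} \<or> V k = range (\<lambda>c. fscale c e0)" using line_dichotomy by blast
    then show ?thesis using e0_in_str[OF k, of d] k by (simp add: spc_str) blast
  qed
  have one: "e0 \<in> U k \<longleftrightarrow> e0 \<notin> W k" if k: "i < k" "k \<le> j" for k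
  proof
    show "e0 \<notin> W k" if "e0 \<in> U k"
      using dir[rule_format, OF inS[OF k]] that e0_simps(3) by blast
    show "e0 \<in> U k" if "e0 \<notin> W k"
    proof (rule ccontr)
      assume "e0 \<notin> U k"
      then have "U k = {0}" "W k = {0}" using line[OF U(1) k] line[OF W(1) k] that by blast+
      then have "spc ?S k = {0}" using dir[rule_format, OF inS[OF k]] by auto
      then show False using spc_str_eq_0_iff[of i j d k] k by blast
    qed
  qed
  have move: "e0 \<in> V (k + 1)" if "is_sub n V ?S" "i < k" "k < j" "d k" "e0 \<in> V k" for V k
    using is_subD(3)[OF that(1) _ that(5)] that assms by (simp add: up_str)
  have move': "e0 \<in> V k" if "is_sub n V ?S" "i < k" "k < j" "\<not> d k" "e0 \<in> V (k + 1)" for V k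
    using is_subD(4)[OF that(1) _ that(5)] that assms by (simp add: dn_str)
  \<comment> \<open>The arrow moves \<open>e0\<close> within \<open>U\<close> and within
    \<open>W\<close>. As \<open>e0\<close> lies in exactly one of them at each vertex, both
    implications follow, whatever the direction of the arrow.\<close>
  have step': "e0 \<in> U (k + 1) \<longleftrightarrow> e0 \<in> U k" if "i < k" "k < j" for k
  proof -
    have "e0 \<in> U k \<longleftrightarrow> e0 \<notin> W k" "e0 \<in> U (k + 1) \<longleftrightarrow> e0 \<notin> W (k + 1)"
      using one[of k] one[of "k + 1"] that by simp_all
    then show ?thesis
      using move[OF U(1) that] move[OF W(1) that] move'[OF U(1) that] move'[OF W(1) that]
      by (cases "d k") blast+
  qed
  have const: "e0 \<in> U k \<longleftrightarrow> e0 \<in> U j" if "k \<le> j" "i < k" for k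
    using that
  proof (induction k rule: inc_induct)
    case (step m)
    then show ?case using step'[of m] by simp
  qed simp
  have ex: "\<exists>k. i < k \<and> k \<le> j \<and> e0 \<in> V k" if V: "is_sub n V ?S" "\<not> is_zero n (restr ?S V)" for V
  proof -
    obtain k where k: "k \<in> {1..n}" "V k \<noteq> {0}" using V(2) by (auto simp: is_zero_def support_def)
    have "V k \<subseteq> spc ?S k" "0 \<in> V k"
      using is_subD(2)[OF V(1) k(1)] fvec.subspace_0[OF is_subD(1)[OF V(1) k(1)]] by auto
    then have "i < k \<and> k \<le> j" using k(2) by (auto simp: spc_str split: if_splits)
    then show ?thesis using line[OF V(1)] k(2) by blast
  qed
  show False using ex[OF U] ex[OF W] const one by metis
  qed
  show False if "\<exists>U W. is_sub n U ?S \<and> is_sub n W ?S \<and> \<not> is_zero n (restr ?S U) \<and> \<not> is_zero n (restr ?S W)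
     \<and> (\<forall>k\<in>{1..n}. U k \<inter> W k = {0} \<and> spc ?S k = {x + y | x y. x \<in> U k \<and> y \<in> W k})"
    using that by (elim exE conjE) (rule key)
qed

text \<open>The image of \<open>s\<close> is nonzero and complementary to the kernel of
  \<open>q\<close>, so indecomposability kills the kernel and \<open>q\<close> is an
  isomorphism.\<close>

lemma indecomposable_retract_str:
  fixes M :: "'k::field rep"
  assumes M: "indecomposable n M"
  obtains i j d q s where "i < j" "j \<le> n" "retract n M (str i j d) q s" "\<And>k. k \<in> {1..n} \<Longrightarrow> kern M q k = {0}"
proof -
  have rep: "is_rep n M" "\<not> is_zero n M" using M by (auto simp: indecomposable_def)
  obtain a r d q s where ar: "a < r" "r \<le> n" and ret: "retract n M (str a r d) q s"
    using string_retract[OF rep] by metis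
  let ?S = "str a r d :: 'k rep"
  have q: "is_hom n M ?S q" and s: "is_hom n ?S M s" and qs: "\<And>k y. k \<in> {1..n} \<Longrightarrow> y \<in> spc ?S k \<Longrightarrow> q k (s k y) = y"
    using ret by (auto simp: retract_def)
  define U where "U k = s k ` spc ?S k" for k
  have sub: "is_sub n (kern M q) M" using is_sub_kern[OF rep(1) is_rep_str q] .
  have U: "is_sub n U M"
    unfolding U_def using is_sub_image[OF is_rep_str is_sub_spc[OF is_rep_str] s] .
  have s0: "s k 0 = 0" if "k \<in> {1..n}" for k using is_hom_zero[OF is_rep_str s that] .
  have "U k \<inter> kern M q k = {0} \<and> spc M k = {x + y | x y. x \<in> U k \<and> y \<in> kern M q k}" if k: "k \<in> {1..n}" for k
  proof
    have "x = 0" if "x \<in> U k" "x \<in> kern M q k" for x using that qs[OF k] s0[OF k] by (auto simp: U_def kern_def)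
    moreover have "0 \<in> U k" "0 \<in> kern M q k"
      using fvec.subspace_0[OF is_subD(1)[OF U k]] fvec.subspace_0[OF is_subD(1)[OF sub k]] by auto
    ultimately show "U k \<inter> kern M q k = {0}" by blast
    show "spc M k = {x + y | x y. x \<in> U k \<and> y \<in> kern M q k}"
    proof (intro equalityI subsetI)
      fix x assume x: "x \<in> spc M k"
      have "x - s k (q k x) \<in> kern M q k"
        using is_hom_in[OF _ k x] retract_projection(1)[OF rep(1) is_rep_str ret] unfolding is_epi_def by fastforce
      moreover have "s k (q k x) \<in> U k" using is_hom_in[OF q k x] by (simp add: U_def)
      moreover have "x = s k (q k x) + (x - s k (q k x))" by simp
      ultimately show "x \<in> {x + y | x y. x \<in> U k \<and> y \<in> kern M q k}" by blast
    next
      fix x assume "x \<in> {x + y | x y. x \<in> U k \<and> y \<in> kern M q k}"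
      then obtain y z where "x = y + z" "y \<in> spc M k" "z \<in> spc M k"
        using is_subD(2)[OF U k] is_subD(2)[OF sub k] by auto
      then show "x \<in> spc M k" using fvec.subspace_add[OF is_rep_subspace[OF rep(1) k]] by simp
    qed
  qed
  then have "is_zero n (restr M U) \<or> is_zero n (restr M (kern M q))"
    using M U sub unfolding indecomposable_def by blast
  moreover have "\<not> is_zero n (restr M U)"
  proof
    assume "is_zero n (restr M U)"
    then have "U r = {0}" using ar by (auto simp: is_zero_def support_def)
    moreover have r: "r \<in> {1..n}" using ar by auto
    moreover have "e0 \<in> spc ?S r" using e0_in_str ar by blast
    ultimately have "s r e0 = 0" by (auto simp: U_def)
    then show False
      using qs[OF r \<open>e0 \<in> spc ?S r\<close>] is_hom_zero[OF rep(1) q r] e0_simps(3) by metis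
  qed
  ultimately have "kern M q k = {0}" if "k \<in> {1..n}" for k
    using that by (auto simp: is_zero_def support_def)
  then show ?thesis using that ar ret by blast
qed

lemma inv_tors_eq_str_invs:
  fixes T :: "'k::field rep set"
  assumes T: "torsion_class n T"
  shows "inv_tors n T = str_invs n T"
proof (intro equalityI subrelI)
  fix i j assume "(i, j) \<in> inv_tors n T"
  then obtain M where M: "M \<in> T" "indecomposable n M" "(i, j) = inv_mod n M" unfolding inv_tors_def by blast
  have rep: "is_rep n M" using torsion_class_rep[OF T M(1)] .
  obtain a b d q s where ab: "a < b" "b \<le> n" and q: "retract n M (str a b d) q s" "\<And>k. k \<in> {1..n} \<Longrightarrow> kern M q k = {0}"
    using indecomposable_retract_str[OF M(2)] by metis
  have "support n M = support n (str a b d :: 'k rep)"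
    using support_eq_if_kern_zero[OF rep is_rep_str retract_epi[OF q(1)] q(2)] .
  then have "(i, j) = (a, b)"
    using M(3) inv_mod_str[OF ab, of d, where 'a='k] by (simp add: inv_mod_def)
  moreover have "str a b d \<in> T" using torsion_class_quot[OF T M(1) is_rep_str retract_epi[OF q(1)]] .
  ultimately show "(i, j) \<in> str_invs n T" using ab unfolding str_invs_def by blast
next
  fix i j assume "(i, j) \<in> str_invs n T"
  then obtain d where ij: "i < j" "j \<le> n" and d: "str i j d \<in> T" unfolding str_invs_def by blast
  then show "(i, j) \<in> inv_tors n T"
    unfolding inv_tors_def using indecomposable_str[OF ij] inv_mod_str[OF ij] by (metis (mono_tags, lifting) mem_Collect_eq)
qed

section \<open>Minimal extending modules\<close>

text \<open>Climbing the chain, each step is an extension with quotient in \<open>S\<close>.\<close>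

lemma Filt_subset_torsion_class:
  assumes T: "torsion_class n T" and S: "S \<subseteq> T"
  shows "Filt n S \<subseteq> T"
proof
  fix N assume "N \<in> Filt n S"
  then obtain l U where N: "is_rep n N" and sub': "\<forall>j\<le>l. is_sub n (U j) N"
    and ends: "\<forall>i\<in>{1..n}. U 0 i = {0} \<and> U l i = spc N i"
    and incl: "\<forall>j<l. (\<forall>i\<in>{1..n}. U j i \<subseteq> U (Suc j) i) \<and> (\<exists>i\<in>{1..n}. U j i \<noteq> U (Suc j) i)"
    and quot: "\<forall>j<l. \<exists>X\<in>S. indecomposable n X \<and> quot_iso n (restr N (U (Suc j))) (U j) X"
    unfolding Filt_def mem_Collect_eq by (elim exE conjE) (rule that)
  have sub: "is_sub n (U j) N" if "j \<le> l" for j using sub' that by blast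
  have "restr N (U j) \<in> T" if "j \<le> l" for j
    using that
  proof (induction j)
    case 0
    then show ?case
      using torsion_class_zero[OF T is_rep_restr[OF N sub]] ends by (simp add: is_zero_def support_def)
  next
    case (Suc j)
    then have jl: "j < l" by simp
    then obtain X where X: "X \<in> S" and "quot_iso n (restr N (U (Suc j))) (U j) X" using quot by blast
    then obtain g where g: "is_epi n (restr N (U (Suc j))) X g"
      "\<And>i. i \<in> {1..n} \<Longrightarrow> {x \<in> U (Suc j) i. g i x = 0} = U j i"
      unfolding quot_iso_def by auto
    have "short_exact n (restr N (U j)) (restr N (U (Suc j))) X (\<lambda>k x. x) g"
      unfolding short_exact_def
    proof (intro conjI ballI g(1))
      have "is_sub n (U j) (restr N (U (Suc j)))"
        using sub[of j] incl jl by (auto simp: is_sub_def)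
      from is_mono_restr[OF this] show "is_mono n (restr N (U j)) (restr N (U (Suc j))) (\<lambda>k x. x)"
        by (simp add: restr_def)
    qed (use g(2) in auto)
    then show ?case
      using torsion_class_ext[OF T _ _ is_rep_restr[OF N sub[OF Suc.prems]]] Suc X S by auto
  qed
  then have "restr N (U l) \<in> T" by simp
  \<comment> \<open>\<open>U l\<close> agrees with \<open>spc N\<close> only on the vertices
    \<open>1..n\<close>, so the records may differ; the identity still is an epimorphism.\<close>
  moreover have "is_epi n (restr N (U l)) N (\<lambda>k x. x)"
    using is_mono_restr[OF sub[of l]] ends by (simp add: is_epi_def is_mono_def)
  ultimately show "N \<in> T" using torsion_class_quot[OF T _ N] by blast
qed

lemma mem_Filt:
  assumes M: "indecomposable n M" "M \<in> S"
  shows "M \<in> Filt n S"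
proof -
  have rep: "is_rep n M" "\<not> is_zero n M" using M by (auto simp: indecomposable_def)
  define U where "U j = (if j = 0 then \<lambda>_. {0} else spc M)" for j :: nat
  have 0: "up M k 0 = 0" "dn M k 0 = 0" if "k \<in> {1..<n}" for k
    using lin_map_subspaces(1)[OF is_rep_arrows(1)[OF rep(1)] is_rep_subspace[OF rep(1)], of k]
      lin_map_subspaces(1)[OF is_rep_arrows(2)[OF rep(1)] is_rep_subspace[OF rep(1)], of k] that by auto
  have 00: "0 \<in> spc M k" if "k \<in> {1..n}" for k
    using fvec.subspace_0[OF is_rep_subspace[OF rep(1) that]] .
  have sub: "is_sub n (U j) M" for j
    unfolding is_sub_def U_def
    using is_rep_subspace[OF rep(1)] 00 fvec.subspace_single_0 0
      lin_map_in[OF is_rep_arrows(1)[OF rep(1)]] lin_map_in[OF is_rep_arrows(2)[OF rep(1)]] by auto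
  have ends: "\<forall>i\<in>{1..n}. U 0 i = {0} \<and> U (Suc 0) i = spc M i" by (simp add: U_def)
  have incl: "\<forall>i\<in>{1..n}. U 0 i \<subseteq> U (Suc 0) i"
    using 00 by (auto simp: U_def)
  have ne: "\<exists>i\<in>{1..n}. U 0 i \<noteq> U (Suc 0) i" using rep(2) by (auto simp: U_def is_zero_def support_def)
  have quot: "quot_iso n (restr M (U (Suc 0))) (U 0) M"
  proof -
    have "is_epi n (restr M (U (Suc 0))) M (\<lambda>k x. x)" by (simp add: U_def restr_def is_epi_def is_hom_id)
    then show ?thesis unfolding quot_iso_def
      using 00 by (intro exI[of _ "\<lambda>k x. x"]) (auto simp: U_def)
  qed
  show ?thesis
    unfolding Filt_def mem_Collect_eq
  proof (intro conjI exI[of _ "Suc 0"] exI[of _ U] rep(1) ends)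
    show "\<forall>j\<le>Suc 0. is_sub n (U j) M" using sub by blast
    show "\<forall>j<Suc 0. (\<forall>i\<in>{1..n}. U j i \<subseteq> U (Suc j) i) \<and> (\<exists>i\<in>{1..n}. U j i \<noteq> U (Suc j) i)"
      using incl ne by (simp only: less_Suc0 simp_thms)
    show "\<forall>j<Suc 0. \<exists>X\<in>S. indecomposable n X \<and> quot_iso n (restr M (U (Suc j))) (U j) X"
      using quot M by (simp only: less_Suc0 simp_thms) blast
  qed
qed

text \<open>\<open>q\<close> is bijective at every vertex, so it carries a decomposition of
  \<open>M\<close> to one of \<open>S\<close>.\<close>

lemma indecomposable_kern_zero:
  assumes M: "is_rep n M" and S: "indecomposable n S" and q: "is_epi n M S q"
    and ker: "\<And>k. k \<in> {1..n} \<Longrightarrow> kern M q k = {0}"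
  shows "indecomposable n M"
proof -
  have repS: "is_rep n S" and nz: "\<not> is_zero n S" using S by (auto simp: indecomposable_def)
  have hq: "is_hom n M S q" and sur: "\<And>k. k \<in> {1..n} \<Longrightarrow> q k ` spc M k = spc S k" using q by (auto simp: is_epi_def)
  have q0: "q k 0 = 0" if "k \<in> {1..n}" for k using is_hom_zero[OF M hq that] .
  have add: "q k (x + y) = q k x + q k y" if "k \<in> {1..n}" "x \<in> spc M k" "y \<in> spc M k" for k x y
    using is_hom_lin[OF hq that(1)] that unfolding lin_map_def by blast
  have inj: "inj_on (q k) (spc M k)" if k: "k \<in> {1..n}" for k
    by (rule inj_on_hom[OF M hq k]) (use ker[OF k] in \<open>auto simp: kern_def\<close>)
  have key: False
    if U: "is_sub n U M" and W: "is_sub n W M" and nzU: "\<not> is_zero n (restr M U)" and nzW: "\<not> is_zero n (restr M W)"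
      and dir: "\<forall>k\<in>{1..n}. U k \<inter> W k = {0} \<and> spc M k = {x + y | x y. x \<in> U k \<and> y \<in> W k}" for U W
  proof -
    let ?U = "\<lambda>k. q k ` U k" and ?W = "\<lambda>k. q k ` W k"
    have sub: "U k \<subseteq> spc M k" "W k \<subseteq> spc M k" if "k \<in> {1..n}" for k
      using is_subD(2)[OF U that] is_subD(2)[OF W that] .
    have nz': "\<not> is_zero n (restr S (\<lambda>k. q k ` V k))" if V: "is_sub n V M" "\<not> is_zero n (restr M V)" for V
    proof -
      obtain k where k: "k \<in> {1..n}" "V k \<noteq> {0}" using V(2) by (auto simp: is_zero_def support_def)
      have "0 \<in> V k" using fvec.subspace_0[OF is_subD(1)[OF V(1) k(1)]] .
      then obtain v where v: "v \<in> V k" "v \<noteq> 0" using k(2) by blast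
      have "v \<in> spc M k" using is_subD(2)[OF V(1) k(1)] v by blast
      then have "q k v \<noteq> 0" using ker[OF k(1)] v(2) by (auto simp: kern_def)
      then have "q k ` V k \<noteq> {0}" using v(1) by blast
      then show ?thesis using k(1) by (auto simp: is_zero_def support_def)
    qed
    have "?U k \<inter> ?W k = {0} \<and> spc S k = {x + y | x y. x \<in> ?U k \<and> y \<in> ?W k}" if k: "k \<in> {1..n}" for k
    proof
      have "?U k \<inter> ?W k = q k ` (U k \<inter> W k)"
        using inj_on_image_Int[OF inj[OF k] sub[OF k]] by simp
      then show "?U k \<inter> ?W k = {0}" using dir k q0[OF k] by simp
      have "spc S k = q k ` {x + y | x y. x \<in> U k \<and> y \<in> W k}" using sur[OF k] dir k by simp
      also have "\<dots> = {x + y | x y. x \<in> ?U k \<and> y \<in> ?W k}"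
      proof (intro equalityI subsetI)
        fix z assume "z \<in> q k ` {x + y | x y. x \<in> U k \<and> y \<in> W k}"
        then obtain x y where xy: "x \<in> U k" "y \<in> W k" "z = q k (x + y)" by blast
        then have "z = q k x + q k y" using add[OF k] sub[OF k] by blast
        then show "z \<in> {x + y | x y. x \<in> ?U k \<and> y \<in> ?W k}" using xy by blast
      next
        fix z assume "z \<in> {x + y | x y. x \<in> ?U k \<and> y \<in> ?W k}"
        then obtain x y where xy: "x \<in> U k" "y \<in> W k" "z = q k x + q k y" by blast
        then have "z = q k (x + y)"
          using add[OF k subsetD[OF sub(1)[OF k] xy(1)] subsetD[OF sub(2)[OF k] xy(2)]] by simp
        then show "z \<in> q k ` {x + y | x y. x \<in> U k \<and> y \<in> W k}" using xy by blast
      qed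
      finally show "spc S k = {x + y | x y. x \<in> ?U k \<and> y \<in> ?W k}" .
    qed
    then show False
      using S is_sub_image[OF M U hq] is_sub_image[OF M W hq] nz'[OF U nzU] nz'[OF W nzW]
      unfolding indecomposable_def by blast
  qed
  have "\<not> is_zero n M"
    using nz support_eq_if_kern_zero[OF M repS q ker] by (simp add: is_zero_def)
  then show ?thesis
    unfolding indecomposable_def using M key by (intro conjI notI; (elim exE conjE)?) (assumption | blast)+
qed

text \<open>A section fixes \<open>e0\<close> at the end of edge \<open>k\<close> that lies in the
  quotient, since \<open>block\<close> is the identity there. Crossing the edge gives
  \<open>e0\<close> in the extension but 0 in the quotient, so the section would send 0 to
  \<open>e0\<close>.\<close>

lemma not_splits_str:
  assumes "i < k" "k < j" "j \<le> n"
  shows "\<not> d k \<Longrightarrow> \<not> splits n (str i j d) (str k j d :: 'k::field rep) (block k j)"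
    and "d k \<Longrightarrow> \<not> splits n (str i j d) (str i k d :: 'k::field rep) (block i k)"
proof -
  have k: "k \<in> {1..<n}" "k \<in> {1..n}" "k + 1 \<in> {1..n}" using assms by auto
  show "\<not> splits n (str i j d) (str k j d :: 'k rep) (block k j)" if d: "\<not> d k"
  proof
    assume "splits n (str i j d) (str k j d :: 'k rep) (block k j)"
    then obtain s where s: "is_hom n (str k j d :: 'k rep) (str i j d) s"
      and g: "\<forall>m\<in>{1..n}. \<forall>x\<in>spc (str k j d :: 'k rep) m. block k j m (s m x) = x"
      unfolding splits_def by blast
    have e: "e0 \<in> spc (str k j d :: 'k rep) (k + 1)" using e0_in_str[of k "k + 1" j] assms by simp
    then have "s (k + 1) e0 = e0" using g k(3) assms by (force simp: block_def)
    moreover have "s k (dn (str k j d) k e0) = dn (str i j d) k (s (k + 1) e0)"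
      using s k(1) e unfolding is_hom_def by blast
    ultimately have "s k 0 = e0" using d assms by (simp add: dn_str)
    then show False using is_hom_zero[OF is_rep_str s k(2)] e0_simps(3) by metis
  qed
  show "\<not> splits n (str i j d) (str i k d :: 'k rep) (block i k)" if d: "d k"
  proof
    assume "splits n (str i j d) (str i k d :: 'k rep) (block i k)"
    then obtain s where s: "is_hom n (str i k d :: 'k rep) (str i j d) s"
      and g: "\<forall>m\<in>{1..n}. \<forall>x\<in>spc (str i k d :: 'k rep) m. block i k m (s m x) = x"
      unfolding splits_def by blast
    have e: "e0 \<in> spc (str i k d :: 'k rep) k" using e0_in_str[of i k k] assms by simp
    then have "s k e0 = e0" using g k(2) assms by (force simp: block_def)
    moreover have "s (k + 1) (up (str i k d) k e0) = up (str i j d) k (s k e0)"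
      using s k(1) e unfolding is_hom_def by blast
    ultimately have "s (k + 1) 0 = e0" using d assms by (simp add: up_str)
    then show False using is_hom_zero[OF is_rep_str s k(3)] e0_simps(3) by metis
  qed
qed

text \<open>Glued strings are extensions by a string; composing with the isomorphism
  \<open>q\<close> turns them into extensions by \<open>M\<close> itself, as (P2) demands.\<close>

lemma short_exact_precomp:
  assumes M: "is_rep n M" and q: "is_epi n M A q" and ker: "\<And>k. k \<in> {1..n} \<Longrightarrow> kern M q k = {0}"
    and ex: "short_exact n A X C f g"
  shows "short_exact n M X C (\<lambda>k x. f k (q k x)) g"
proof -
  have hq: "is_hom n M A q" and sur: "\<And>k. k \<in> {1..n} \<Longrightarrow> q k ` spc M k = spc A k" using q by (auto simp: is_epi_def)
  have hf: "is_hom n A X f" and injf: "\<And>k. k \<in> {1..n} \<Longrightarrow> inj_on (f k) (spc A k)"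
    and img: "\<And>k. k \<in> {1..n} \<Longrightarrow> f k ` spc A k = {x \<in> spc X k. g k x = 0}" and g: "is_epi n X C g"
    using ex by (auto simp: short_exact_def is_mono_def)
  have "inj_on (\<lambda>x. f k (q k x)) (spc M k)" if k: "k \<in> {1..n}" for k
  proof -
    have "inj_on (q k) (spc M k)"
      by (rule inj_on_hom[OF M hq k]) (use ker[OF k] in \<open>auto simp: kern_def\<close>)
    then show ?thesis using comp_inj_on[of "q k" "spc M k" "f k"] injf[OF k] sur[OF k] by (simp add: o_def)
  qed
  moreover have "(\<lambda>x. f k (q k x)) ` spc M k = {x \<in> spc X k. g k x = 0}" if k: "k \<in> {1..n}" for k
    using img[OF k] sur[OF k] by (metis image_image)
  ultimately show ?thesis using is_hom_comp[OF hq hf] g by (simp add: short_exact_def is_mono_def)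
qed

text \<open>For the enlarged set, transitivity concerns only pairs adjacent to \<open>(a, r)\<close>
  on the left or right, and these correspond to extensions of a member of \<open>T\<close> by
  \<open>M\<close>. Coclosedness at \<open>(a, r)\<close> concerns only proper quotients of
  \<open>M\<close>.\<close>

lemma minimal_extending_str:
  fixes T :: "'k::field rep set"
  assumes T: "torsion_class n T" and ext: "minimal_extending n T M"
  obtains a r where "inv_mod n M = (a, r)" "indecomposable n M" "(a, r) \<notin> str_invs n T"
    "biclosed n (insert (a, r) (str_invs n T))" "M \<in> tors_of n (insert (a, r) (str_invs n T))"
proof -
  note ext' = ext[unfolded minimal_extending_def]
  note rep = ext'[THEN conjunct1] and nz = ext'[THEN conjunct2, THEN conjunct1]
    and P1' = ext'[THEN conjunct2, THEN conjunct2, THEN conjunct1]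
    and P2 = ext'[THEN conjunct2, THEN conjunct2, THEN conjunct2, THEN conjunct1]
    and P3 = ext'[THEN conjunct2, THEN conjunct2, THEN conjunct2, THEN conjunct2]
  have P1: "N \<in> T" if N: "is_rep n N" and f: "is_epi n M N f" and k: "k \<in> {1..n}" "kern M f k \<noteq> {0}" for N f k
  proof -
    have "is_hom n M N f" using f by (simp add: is_epi_def)
    then have "is_sub n (kern M f) M" using is_sub_kern[OF rep N] by blast
    moreover have "\<not> is_zero n (restr M (kern M f))" using k by (auto simp: is_zero_def support_def)
    moreover have "quot_iso n M (kern M f) N" using f unfolding quot_iso_def kern_def by blast
    ultimately show ?thesis using P1' N by blast
  qed
  obtain a r d q s where ar: "a < r" "r \<le> n" and ret: "retract n M (str a r d) q s"
    using string_retract[OF rep nz] by metis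
  let ?S = "str a r d :: 'k rep"
  have q: "is_epi n M ?S q" using retract_epi[OF ret] .
  have s: "is_hom n ?S M s" and qs: "\<And>k y. k \<in> {1..n} \<Longrightarrow> y \<in> spc ?S k \<Longrightarrow> q k (s k y) = y"
    using ret by (auto simp: retract_def)
  have hq: "is_hom n M ?S q" using q by (simp add: is_epi_def)
  have q0: "q k 0 = 0" if "k \<in> {1..n}" for k using is_hom_zero[OF rep hq that] .
  have s_ne: "s k y \<noteq> 0" if "k \<in> {1..n}" "y \<in> spc ?S k" "y \<noteq> 0" for k y
    using qs[OF that(1,2)] q0[OF that(1)] that(3) by auto
  have vert: "k \<in> {1..n}" if "a < k" "k \<le> r" for k using that ar by auto
  \<comment> \<open>A nonzero kernel would put the string in \<open>T\<close> by (P1), and then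
    \<open>s\<close> would be a nonzero map from \<open>T\<close> to \<open>M\<close>.\<close>
  have ker: "kern M q k = {0}" if k: "k \<in> {1..n}" for k
  proof (rule ccontr)
    assume "kern M q k \<noteq> {0}"
    then have "?S \<in> T" using P1[OF is_rep_str q k] by blast
    moreover have "e0 \<in> spc ?S r" using e0_in_str ar by blast
    ultimately have "s r e0 = 0" using P3 s vert[of r] ar by blast
    then show False using s_ne[of r e0] vert[of r] ar e0_in_str[of a r r] e0_simps(3) by auto
  qed
  have supp: "support n M = support n ?S" using support_eq_if_kern_zero[OF rep is_rep_str q ker] .
  then have inv: "inv_mod n M = (a, r)" using inv_mod_str[OF ar, of d, where 'a='k] by (simp add: inv_mod_def)
  have indec: "indecomposable n M" using indecomposable_kern_zero[OF rep indecomposable_str[OF ar] q ker] .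
  \<comment> \<open>A string of \<open>T\<close> on the same interval maps nontrivially to the
    string of \<open>M\<close>; composed with the injective \<open>s\<close>, this contradicts
    (P3).\<close>
  have new: "(a, r) \<notin> str_invs n T"
  proof
    assume "(a, r) \<in> str_invs n T"
    then obtain d' where d': "str a r d' \<in> T" unfolding str_invs_def by blast
    obtain f k x where f: "is_hom n (str a r d' :: 'k rep) ?S f" "k \<in> {1..n}" "x \<in> spc (str a r d') k" "f k x \<noteq> 0"
      using str_hom_same_support[OF ar, of d' d] by metis
    have "is_hom n (str a r d') M (\<lambda>k x. s k (f k x))" using is_hom_comp[OF f(1) s] .
    then have "s k (f k x) = 0" using P3 d' f(2,3) by blast
    then show False using s_ne[OF f(2) is_hom_in[OF f(1,2,3)] f(4)] by blast
  qed
  let ?A = "str_invs n T"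
  have bA: "trans ?A" "\<And>i j. (i, j) \<in> ?A \<Longrightarrow> i < j \<and> j \<le> n"
    "\<And>i k j. i < k \<Longrightarrow> k < j \<Longrightarrow> (i, j) \<in> ?A \<Longrightarrow> (i, k) \<in> ?A \<or> (k, j) \<in> ?A"
    using biclosed_str_invs[OF T] unfolding biclosed_def by blast+
  have proper: "(a', b') \<in> ?A"
    if *: "a \<le> a'" "a' < b'" "b' \<le> r" "a < a' \<Longrightarrow> \<not> d a'" "b' < r \<Longrightarrow> d b'" "(a', b') \<noteq> (a, r)" for a' b'
  proof -
    let ?f = "\<lambda>k x. block a' b' k (q k x)"
    have f: "is_epi n M (str a' b' d) ?f"
      by (rule is_epi_comp[OF q is_epi_block]) (use * in auto)
    \<comment> \<open>A vertex lost in passing to the shorter interval. There \<open>s v e0\<close>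
      lies in the kernel, so the quotient is proper and (P1) applies.\<close>
    obtain v where v: "a < v" "v \<le> r" "\<not> (a' < v \<and> v \<le> b')"
      using *(1,3,6) ar by (cases "a = a'") (fastforce, metis le_less_trans linorder_not_le nat_less_le order_refl)
    have e: "e0 \<in> spc ?S v" using e0_in_str[OF v(1,2)] .
    have "s v e0 \<in> kern M ?f v"
      using is_hom_in[OF s vert[OF v(1,2)] e] v(3) by (auto simp: kern_def block_def)
    then have "kern M ?f v \<noteq> {0}" using s_ne[OF vert[OF v(1,2)] e e0_simps(3)] by blast
    then have "str a' b' d \<in> T" using P1[OF is_rep_str f vert[OF v(1,2)]] by blast
    then show ?thesis using * ar unfolding str_invs_def by auto
  qed
  have right: "(a, c) \<in> ?A" if rc: "(r, c) \<in> ?A" for c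
  proof -
    obtain d' where d': "r < c" "c \<le> n" "str r c d' \<in> T" using rc unfolding str_invs_def by blast
    \<comment> \<open>The value \<open>False\<close> at \<open>r\<close> points the glueing edge
      into the support of \<open>M\<close>, which makes \<open>M\<close> the submodule and the
      string of \<open>T\<close> the quotient.\<close>
    define D where "D = (\<lambda>m. if m < r then d m else if m = r then False else d' m)"
    have D: "?S = str a r D" "(str r c d' :: 'k rep) = str r c D" by (auto intro!: str_cong simp: D_def)
    have "short_exact n (str a r D :: 'k rep) (str a c D) (str r c D) (block a r) (block r c)"
      by (rule short_exact_str(2)) (use ar d' in \<open>auto simp: D_def\<close>)
    then have "short_exact n M (str a c D) (str r c D) (\<lambda>k x. block a r k (q k x)) (block r c)"
      using short_exact_precomp[OF rep q ker] D(1) by simp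
    moreover have "\<not> splits n (str a c D) (str r c D :: 'k rep) (block r c)"
      by (rule not_splits_str(1)) (use ar d' in \<open>auto simp: D_def\<close>)
    ultimately have "str a c D \<in> T" using P2 d'(3) D(2) is_rep_str by metis
    then show ?thesis using ar d' unfolding str_invs_def by auto
  qed
  have left: "(c, r) \<in> ?A" if ca: "(c, a) \<in> ?A" for c
  proof -
    obtain d' where d': "c < a" "str c a d' \<in> T" using ca unfolding str_invs_def by blast
    \<comment> \<open>At the left end the value \<open>True\<close> points the edge into the support
      of \<open>M\<close>.\<close>
    define D where "D = (\<lambda>m. if m < a then d' m else if m = a then True else d m)"
    have D: "?S = str a r D" "(str c a d' :: 'k rep) = str c a D" by (auto intro!: str_cong simp: D_def)
    have "short_exact n (str a r D :: 'k rep) (str c r D) (str c a D) (block a r) (block c a)"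
      by (rule short_exact_str(1)) (use ar d' in \<open>auto simp: D_def\<close>)
    then have "short_exact n M (str c r D) (str c a D) (\<lambda>k x. block a r k (q k x)) (block c a)"
      using short_exact_precomp[OF rep q ker] D(1) by simp
    moreover have "\<not> splits n (str c r D) (str c a D :: 'k rep) (block c a)"
      by (rule not_splits_str(2)) (use ar d' in \<open>auto simp: D_def\<close>)
    ultimately have "str c r D \<in> T" using P2 d'(2) D(2) is_rep_str by metis
    then show ?thesis using ar d' unfolding str_invs_def by auto
  qed
  \<comment> \<open>Cut at edge \<open>k\<close>: one of the two parts is a proper quotient.\<close>
  have co: "(a, k) \<in> ?A \<or> (k, r) \<in> ?A" if "a < k" "k < r" for k
    using proper[of a k] proper[of k r] that by (cases "d k") auto
  have "trans (insert (a, r) ?A)"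
    using bA(1) left right ar unfolding trans_def by blast
  then have "biclosed n (insert (a, r) ?A)"
    unfolding biclosed_def using bA(2,3) co ar by blast
  moreover have "M \<in> tors_of n (insert (a, r) ?A)"
    unfolding tors_of_def mem_Collect_eq
  proof (intro conjI allI impI rep)
    fix i j d' f assume *: "i < j \<and> j \<le> n \<and> is_epi n M (str i j d' :: 'k rep) f"
    show "(i, j) \<in> insert (a, r) ?A"
    \<comment> \<open>Either the quotient is proper and in \<open>T\<close> by (P1), or
      \<open>f\<close> is an isomorphism and the supports agree.\<close>
    proof (cases "\<exists>k\<in>{1..n}. kern M f k \<noteq> {0}")
      case True
      then have "str i j d' \<in> T" using P1[OF is_rep_str] * by blast
      then show ?thesis using * unfolding str_invs_def by blast
    next
      case False
      then have "support n M = support n (str i j d' :: 'k rep)"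
        using support_eq_if_kern_zero[OF rep is_rep_str] * by blast
      then have "inv_mod n M = (i, j)" using inv_mod_str[of i j n d', where 'a='k] * by (simp add: inv_mod_def)
      then show ?thesis using inv by simp
    qed
  qed
  ultimately show ?thesis using that inv indec new by blast
qed

section \<open>The inversion gained by a minimal extension\<close>

lemma tors_of_mono: "A \<subseteq> B \<Longrightarrow> tors_of n A \<subseteq> tors_of n B"
  unfolding tors_of_def by blast

lemma str_invs_mono: "T \<subseteq> T' \<Longrightarrow> str_invs n T \<subseteq> str_invs n T'"
  unfolding str_invs_def by blast

lemma inv_tors_minimal_extension:
  fixes T :: "'k::field rep set"
  assumes T: "torsion_class n T" and T': "torsion_class n (Filt n (T \<union> {M}))" and ext: "minimal_extending n T M"
  shows "inv_tors n (Filt n (T \<union> {M})) - inv_tors n T = {inv_mod n M}"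
proof -
  obtain a r where inv: "inv_mod n M = (a, r)" and M: "indecomposable n M" and new: "(a, r) \<notin> str_invs n T"
    and bi: "biclosed n (insert (a, r) (str_invs n T))" and MA: "M \<in> tors_of n (insert (a, r) (str_invs n T))"
    using minimal_extending_str[OF T ext] by metis
  let ?A = "insert (a, r) (str_invs n T)"
  let ?F = "Filt n (T \<union> {M})"
  have "T \<subseteq> tors_of n ?A" using tors_of_str_invs[OF T] tors_of_mono[of "str_invs n T" ?A n] by blast
  moreover have tA: "torsion_class n (tors_of n ?A :: 'k rep set)"
    using bi unfolding biclosed_def by (intro torsion_class_tors_of) (elim conjE)
  ultimately have "?F \<subseteq> tors_of n ?A" using Filt_subset_torsion_class[OF tA] MA by simp
  then have "str_invs n ?F \<subseteq> ?A" using str_invs_mono str_invs_tors_of[OF bi] by metis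
  moreover have "M \<in> ?F" using mem_Filt[OF M] by blast
  then have "(a, r) \<in> inv_tors n ?F" using M inv unfolding inv_tors_def by force
  ultimately show ?thesis
    using inv_tors_eq_str_invs[OF T] inv_tors_eq_str_invs[OF T'] new inv by auto
qed

section \<open>Biclosed sets and permutations\<close>

text \<open>\<open>inv w x\<close> is the position of the value \<open>x\<close>: inversions are
  recorded by values and tested by positions.\<close>

lemma mem_inversions_iff:
  assumes w: "w permutes {0..n}"
  shows "(x, y) \<in> inversions n w \<longleftrightarrow> x < y \<and> y \<le> n \<and> inv w y < inv w x"
proof
  assume "(x, y) \<in> inversions n w"
  then obtain i j where ij: "x = w j" "y = w i" "i < j" "j \<le> n" "w i > w j" unfolding inversions_def by blast
  moreover have "w i \<le> n" using permutes_in_image[OF w, of i] ij by simp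
  ultimately show "x < y \<and> y \<le> n \<and> inv w y < inv w x" using permutes_inverses(2)[OF w] by simp
next
  assume *: "x < y \<and> y \<le> n \<and> inv w y < inv w x"
  have "inv w x \<le> n" using permutes_in_image[OF permutes_inv[OF w], of x] * by simp
  moreover have "w (inv w x) = x" "w (inv w y) = y" using permutes_inverses(1)[OF w] by auto
  ultimately show "(x, y) \<in> inversions n w"
    unfolding inversions_def using * by (intro CollectI exI[of _ "inv w y"] exI[of _ "inv w x"]) simp
qed

lemma biclosed_inversions:
  assumes w: "w permutes {0..n}"
  shows "biclosed n (inversions n w)"
  unfolding biclosed_def trans_def mem_inversions_iff[OF w] by auto

text \<open>The order in which two values appear in the one-line notation of the permutation with
  inversion set \<open>A\<close>. For biclosed \<open>A\<close> it is a strict linear order.\<close>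

definition precedes :: "(nat \<times> nat) set \<Rightarrow> nat \<Rightarrow> nat \<Rightarrow> bool" where
  "precedes A x y \<longleftrightarrow> (x < y \<and> (x, y) \<notin> A) \<or> (y < x \<and> (y, x) \<in> A)"

lemma precedes_inversions:
  assumes w: "w permutes {0..n}" and "x \<le> n" "y \<le> n"
  shows "precedes (inversions n w) x y \<longleftrightarrow> inv w x < inv w y"
proof -
  have "inv w x = inv w y \<longleftrightarrow> x = y" by (metis permutes_inverses(1)[OF w])
  then show ?thesis
    unfolding precedes_def mem_inversions_iff[OF w] using assms(2,3) by (cases x y rule: linorder_cases) auto
qed

text \<open>Used for \<open>p = inv w\<close>: the position of a value is the number of values
  before it, so \<open>precedes\<close> determines the permutation.\<close>

lemma position_eq_card:
  assumes p: "p permutes {0..n::nat}" and x: "x \<le> n"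
  shows "card {z \<in> {0..n}. p z < p x} = p x"
proof -
  have "p ` {z \<in> {0..n}. p z < p x} = {0..<p x}"
  proof (intro equalityI subsetI)
    fix m assume m: "m \<in> {0..<p x}"
    have "p x \<le> n" using permutes_in_image[OF p, of x] x by simp
    then have "inv p m \<in> {0..n}" using permutes_in_image[OF permutes_inv[OF p], of m] m by simp
    moreover have "p (inv p m) = m" using permutes_inverses(1)[OF p] .
    ultimately show "m \<in> p ` {z \<in> {0..n}. p z < p x}" using m by (intro image_eqI[of _ _ "inv p m"]) auto
  qed auto
  then show ?thesis using card_image[OF permutes_inj_on[OF p], of "{z \<in> {0..n}. p z < p x}"] by simp
qed

lemma inversions_inj:
  assumes v: "v permutes {0..n}" and w: "w permutes {0..n}" and eq: "inversions n v = inversions n w"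
  shows "v = w"
proof -
  have "inv v x = inv w x" for x
  proof (cases "x \<le> n")
    case True
    have "{z \<in> {0..n}. inv v z < inv v x} = {z \<in> {0..n}. inv w z < inv w x}"
      using precedes_inversions[OF v _ True] precedes_inversions[OF w _ True] eq by auto
    then show ?thesis
      using position_eq_card[OF permutes_inv[OF v] True] position_eq_card[OF permutes_inv[OF w] True] by simp
  next
    case False
    then show ?thesis using permutes_not_in[OF permutes_inv[OF v], of x] permutes_not_in[OF permutes_inv[OF w], of x] by simp
  qed
  then have "inv v = inv w" by blast
  then show ?thesis by (metis permutes_inv_inv[OF v] permutes_inv_inv[OF w])
qed

text \<open>A failure on distinct values is a cycle. On \<open>i < k < j\<close> there are two:
  \<open>(i, k)\<close> and \<open>(k, j)\<close> are in \<open>A\<close> without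
  \<open>(i, j)\<close>, which transitivity excludes, or \<open>(i, j)\<close> is in
  \<open>A\<close> without either, which coclosedness excludes.\<close>

lemma precedes_trans:
  assumes A: "biclosed n A" and "precedes A x y" "precedes A y z"
  shows "precedes A x z"
proof -
  have tr: "(i, j) \<in> A" if "(i, k) \<in> A" "(k, j) \<in> A" for i j k
    using A that unfolding biclosed_def by (metis transD)
  have co: "(i, k) \<in> A \<or> (k, j) \<in> A" if "i < k" "k < j" "(i, j) \<in> A" for i j k
    using A that unfolding biclosed_def by metis
  consider "x < y" "(x, y) \<notin> A" | "y < x" "(y, x) \<in> A" using assms(2) precedes_def by blast
  then show ?thesis
  proof cases
    case 1
    consider "y < z" "(y, z) \<notin> A" | "z < y" "(z, y) \<in> A" using assms(3) precedes_def by blast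
    then show ?thesis
    proof cases
      case 1 then show ?thesis using co[of x y z] \<open>x < y\<close> \<open>(x, y) \<notin> A\<close> by (auto simp: precedes_def)
    next
      case 2 then show ?thesis using co[of z x y] tr[of x z y] \<open>x < y\<close> \<open>(x, y) \<notin> A\<close>
        by (cases x z rule: linorder_cases) (auto simp: precedes_def)
    qed
  next
    case 2
    consider "y < z" "(y, z) \<notin> A" | "z < y" "(z, y) \<in> A" using assms(3) precedes_def by blast
    then show ?thesis
    proof cases
      case 1 then show ?thesis using co[of y z x] tr[of y x z] \<open>y < x\<close> \<open>(y, x) \<in> A\<close>
        by (cases x z rule: linorder_cases) (auto simp: precedes_def)
    next
      case 2 then show ?thesis using tr[of z y x] \<open>y < x\<close> \<open>(y, x) \<in> A\<close> by (auto simp: precedes_def)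
    qed
  qed
qed

lemma biclosed_imp_inversions:
  assumes A: "biclosed n A"
  obtains w where "w permutes {0..n}" "inversions n w = A"
proof -
  \<comment> \<open>The intended position of \<open>x\<close>, counted from 0, is the number of
    values preceding it; the permutation sought is the inverse of \<open>p\<close>. Above
    \<open>n\<close> the identity is needed for \<open>permutes\<close>.\<close>
  define p where "p x = (if x \<le> n then card {z \<in> {0..n}. precedes A z x} else x)" for x
  have irr: "\<not> precedes A x x" for x by (simp add: precedes_def)
  have mono: "p x < p y" if "precedes A x y" "x \<le> n" "y \<le> n" for x y
  proof -
    have "{z \<in> {0..n}. precedes A z x} \<subset> {z \<in> {0..n}. precedes A z y}"
      using precedes_trans[OF A _ that(1)] that irr by auto
    then show ?thesis unfolding p_def using that by (simp add: psubset_card_mono)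
  qed
  have total: "precedes A x y \<or> precedes A y x" if "x \<noteq> y" for x y
    using that by (cases x y rule: linorder_cases) (auto simp: precedes_def)
  have iff: "precedes A x y \<longleftrightarrow> p x < p y" if "x \<le> n" "y \<le> n" for x y
    using mono[of x y] mono[of y x] total[of x y] irr that by (metis less_asym less_irrefl)
  have "inj_on p {0..n}"
  proof (rule inj_onI)
    fix x y assume "x \<in> {0..n}" "y \<in> {0..n}" "p x = p y"
    then show "x = y" using total[of x y] iff[of x y] iff[of y x] by auto
  qed
  moreover have "p ` {0..n} \<subseteq> {0..n}"
  proof (rule image_subsetI)
    fix x assume x: "x \<in> {0..n}"
    \<comment> \<open>No value precedes itself, so at most \<open>n\<close> of the
      \<open>n + 1\<close> values are counted.\<close>
    have "{z \<in> {0..n}. precedes A z x} \<subseteq> {0..n} - {x}" using irr by auto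
    then have "card {z \<in> {0..n}. precedes A z x} \<le> card ({0..n} - {x})" by (intro card_mono) auto
    then show "p x \<in> {0..n}" using x by (simp add: p_def)
  qed
  ultimately have "bij_betw p {0..n} {0..n}" by (simp add: bij_betw_def endo_inj_surj)
  then have p: "p permutes {0..n}" by (rule bij_imp_permutes) (simp add: p_def)
  let ?w = "inv p"
  have w: "?w permutes {0..n}" using permutes_inv[OF p] .
  have "(x, y) \<in> inversions n ?w \<longleftrightarrow> (x, y) \<in> A" for x y
  proof -
    have "(x, y) \<in> A \<longleftrightarrow> x < y \<and> y \<le> n \<and> precedes A y x"
      using A unfolding biclosed_def by (auto simp: precedes_def)
    then show ?thesis
      unfolding mem_inversions_iff[OF w] permutes_inv_inv[OF p] using iff[of y x] by auto
  qed
  then have "inversions n ?w = A" by (intro equalityI subrelI) blast+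
  then show ?thesis using that w by blast
qed

section \<open>The lattice isomorphism\<close>

text \<open>Least upper and greatest lower bounds are transported along the order isomorphism. The
  lattice property of the second structure is thereby obtained, which is how the weak order is seen
  to be a lattice.\<close>

lemma lattice_isomorphicI:
  fixes C :: "'a set" and D :: "'b set"
  assumes lat: "lattice \<lparr>carrier = C, eq = (=), le = r\<rparr>" (is "lattice ?L") and bij: "bij_betw \<phi> C D"
    and ord: "\<And>x y. x \<in> C \<Longrightarrow> y \<in> C \<Longrightarrow> r x y \<longleftrightarrow> r' (\<phi> x) (\<phi> y)"
  shows "lattice_isomorphic \<lparr>carrier = C, eq = (=), le = r\<rparr> \<lparr>carrier = D, eq = (=), le = r'\<rparr>" (is "lattice_isomorphic _ ?L'")
proof -
  interpret L: lattice ?L by (rule lat)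
  have D: "D = \<phi> ` C" and inj: "inj_on \<phi> C" using bij by (auto simp: bij_betw_def)
  have refl: "r x x" if "x \<in> C" for x using L.le_refl[of x] that by simp
  have tr: "r x z" if "r x y" "r y z" "x \<in> C" "y \<in> C" "z \<in> C" for x y z using L.le_trans[of x y z] that by simp
  have anti: "x = y" if "r x y" "r y x" "x \<in> C" "y \<in> C" for x y using L.le_antisym[of x y] that by simp
  interpret L': partial_order ?L'
  proof
    fix x y z
    show "x \<in> carrier ?L' \<Longrightarrow> x \<sqsubseteq>\<^bsub>?L'\<^esub> x" using refl ord by (auto simp: D)
    show "x \<sqsubseteq>\<^bsub>?L'\<^esub> y \<Longrightarrow> y \<sqsubseteq>\<^bsub>?L'\<^esub> x \<Longrightarrow> x \<in> carrier ?L' \<Longrightarrow> y \<in> carrier ?L' \<Longrightarrow> x .=\<^bsub>?L'\<^esub> y"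
      using anti ord by (auto simp: D)
    show "x \<sqsubseteq>\<^bsub>?L'\<^esub> y \<Longrightarrow> y \<sqsubseteq>\<^bsub>?L'\<^esub> z \<Longrightarrow> x \<in> carrier ?L' \<Longrightarrow> y \<in> carrier ?L' \<Longrightarrow> z \<in> carrier ?L' \<Longrightarrow> x \<sqsubseteq>\<^bsub>?L'\<^esub> z"
      using tr ord by (auto simp: D)
  qed auto
  have lst: "least ?L' (\<phi> z) (Upper ?L' {\<phi> x, \<phi> y})" if "least ?L z (Upper ?L {x, y})" "x \<in> C" "y \<in> C" for x y z
    using that ord unfolding least_def Upper_def D by auto
  have grt: "greatest ?L' (\<phi> z) (Lower ?L' {\<phi> x, \<phi> y})" if "greatest ?L z (Lower ?L {x, y})" "x \<in> C" "y \<in> C" for x y z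
    using that ord unfolding greatest_def Lower_def D by auto
  have join: "least ?L' (\<phi> (x \<squnion>\<^bsub>?L\<^esub> y)) (Upper ?L' {\<phi> x, \<phi> y})" if "x \<in> C" "y \<in> C" for x y
    using lst[OF L.sup_of_two_least[of x y]] that by (simp add: join_def)
  have meet: "greatest ?L' (\<phi> (x \<sqinter>\<^bsub>?L\<^esub> y)) (Lower ?L' {\<phi> x, \<phi> y})" if "x \<in> C" "y \<in> C" for x y
    using grt[OF L.inf_of_two_greatest[of x y]] that by (simp add: meet_def)
  interpret L': lattice ?L'
  proof
    show "\<exists>s. least ?L' s (Upper ?L' {x, y})" if "x \<in> carrier ?L'" "y \<in> carrier ?L'" for x y
      using that join by (auto simp: D)
    show "\<exists>s. greatest ?L' s (Lower ?L' {x, y})" if "x \<in> carrier ?L'" "y \<in> carrier ?L'" for x y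
      using that meet by (auto simp: D)
  qed
  have "\<phi> (x \<squnion>\<^bsub>?L\<^esub> y) = \<phi> x \<squnion>\<^bsub>?L'\<^esub> \<phi> y" if "x \<in> C" "y \<in> C" for x y
    using L'.least_unique[OF join[OF that]] L'.sup_of_two_least[of "\<phi> x" "\<phi> y"] that by (simp add: join_def D)
  moreover have "\<phi> (x \<sqinter>\<^bsub>?L\<^esub> y) = \<phi> x \<sqinter>\<^bsub>?L'\<^esub> \<phi> y" if "x \<in> C" "y \<in> C" for x y
    using L'.greatest_unique[OF meet[OF that]] L'.inf_of_two_greatest[of "\<phi> x" "\<phi> y"] that by (simp add: meet_def D)
  ultimately have "join_pres ?L ?L' \<phi>" "meet_pres ?L ?L' \<phi>"
    unfolding join_pres_def meet_pres_def using lat L'.lattice_axioms by simp_all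
  then show ?thesis unfolding lattice_isomorphic_def using bij by auto
qed

section \<open>Joins and meets of torsion classes\<close>

lemma torsion_class_Inter:
  fixes F :: "'k::field rep set set"
  assumes "F \<noteq> {}" and T: "\<And>T. T \<in> F \<Longrightarrow> torsion_class n T"
  shows "torsion_class n (\<Inter>F)"
proof (rule torsion_classI)
  have "is_zero n (str n n (\<lambda>_. True) :: 'k rep)" by (auto simp: is_zero_def support_str)
  then have "(str n n (\<lambda>_. True) :: 'k rep) \<in> \<Inter>F"
    using torsion_class_zero[OF T is_rep_str] by blast
  then show "\<Inter>F \<noteq> {}" by blast
  show "is_rep n M" if "M \<in> \<Inter>F" for M
    using that assms(1) torsion_class_rep[OF T] by blast
  show "N \<in> \<Inter>F" if "M \<in> \<Inter>F" "is_rep n N" "is_epi n M N f" for M N f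
    using torsion_class_quot[OF T _ that(2,3)] that(1) by blast
  show "B \<in> \<Inter>F" if "A \<in> \<Inter>F" "C \<in> \<Inter>F" "is_rep n B" "short_exact n A B C f g" for A B C f g
    using torsion_class_ext[OF T _ _ that(3,4)] that(1,2) by blast
qed

lemma torsion_class_all: "torsion_class n {M :: 'k::field rep. is_rep n M}"
proof (rule torsion_classI)
  show "{M :: 'k rep. is_rep n M} \<noteq> {}" using is_rep_str by blast
qed auto

text \<open>Meets are intersections. A join is the intersection of all torsion classes above, a
  nonempty family because all modules together form a torsion class.\<close>

lemma lattice_tors: "lattice (tors n :: 'k::field rep set gorder)"
proof -
  let ?L = "tors n :: 'k rep set gorder"
  have sup: "least ?L (\<Inter>{Z. torsion_class n Z \<and> X \<subseteq> Z \<and> Y \<subseteq> Z}) (Upper ?L {X, Y})"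
    if "torsion_class n X" "torsion_class n Y" for X Y :: "'k rep set"
  proof -
    have "X \<subseteq> {M. is_rep n M}" "Y \<subseteq> {M. is_rep n M}" using that torsion_class_rep by blast+
    then have "{Z. torsion_class n Z \<and> X \<subseteq> Z \<and> Y \<subseteq> Z} \<noteq> {}" using torsion_class_all by blast
    then have "torsion_class n (\<Inter>{Z. torsion_class n Z \<and> X \<subseteq> Z \<and> Y \<subseteq> Z})"
      by (rule torsion_class_Inter) simp
    then show ?thesis using that unfolding least_def Upper_def tors_def by auto
  qed
  have inf: "greatest ?L (X \<inter> Y) (Lower ?L {X, Y})"
    if "torsion_class n X" "torsion_class n Y" for X Y :: "'k rep set"
  proof -
    have "torsion_class n (\<Inter>{X, Y})" by (rule torsion_class_Inter) (use that in auto)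
    then show ?thesis using that unfolding greatest_def Lower_def tors_def by auto
  qed
  show ?thesis
  proof
    show "\<exists>s. least ?L s (Upper ?L {X, Y})" if "X \<in> carrier ?L" "Y \<in> carrier ?L" for X Y
      using sup[of X Y] that by (auto simp: tors_def)
    show "\<exists>s. greatest ?L s (Lower ?L {X, Y})" if "X \<in> carrier ?L" "Y \<in> carrier ?L" for X Y
      using inf[of X Y] that by (auto simp: tors_def)
  qed (auto simp: tors_def)
qed

lemma lattice_isomorphic_tors_weak_order:
  "lattice_isomorphic (tors n :: 'k::field rep set gorder) (weak_order n)"
proof -
  define \<phi> where "\<phi> T = (SOME w. w permutes {0..n} \<and> inversions n w = str_invs n T)" for T :: "'k rep set"
  have \<phi>: "\<phi> T permutes {0..n} \<and> inversions n (\<phi> T) = str_invs n T" if T: "torsion_class n T" for T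
  proof -
    obtain w where "w permutes {0..n}" "inversions n w = str_invs n T"
      by (rule biclosed_imp_inversions[OF biclosed_str_invs[OF T]])
    then have "\<exists>w. w permutes {0..n} \<and> inversions n w = str_invs n T" by blast
    then show ?thesis unfolding \<phi>_def by (rule someI_ex)
  qed
  \<comment> \<open>\<open>str_invs\<close> and \<open>tors_of\<close> are monotone, and the latter
    recovers a torsion class from its pairs, so the order is both preserved and reflected.\<close>
  have le: "T \<subseteq> T' \<longleftrightarrow> inversions n (\<phi> T) \<subseteq> inversions n (\<phi> T')"
    if "torsion_class n T" "torsion_class n T'" for T T'
    using \<phi>[OF that(1)] \<phi>[OF that(2)] tors_of_str_invs[OF that(1)] tors_of_str_invs[OF that(2)]
      tors_of_mono[of "str_invs n T" "str_invs n T'" n] str_invs_mono[of T T' n] by auto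
  have "inj_on \<phi> {T. torsion_class n T}"
  proof (rule inj_onI)
    fix T T' assume "T \<in> {T. torsion_class n T}" "T' \<in> {T. torsion_class n T}" "\<phi> T = \<phi> T'"
    then show "T = T'" using le[of T T'] le[of T' T] by auto
  qed
  moreover have "\<phi> ` {T. torsion_class n T} = {w. w permutes {0..n}}"
  proof (intro equalityI subsetI)
    fix w assume "w \<in> {w. w permutes {0..n}}"
    then have w: "w permutes {0..n}" by simp
    have bi: "biclosed n (inversions n w)" using biclosed_inversions[OF w] .
    let ?T = "tors_of n (inversions n w) :: 'k rep set"
    have T: "torsion_class n ?T"
      using bi unfolding biclosed_def by (intro torsion_class_tors_of) (elim conjE)
    have "inversions n (\<phi> ?T) = inversions n w" using \<phi>[OF T] str_invs_tors_of[OF bi, where 'k='k] by simp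
    then have "\<phi> ?T = w" using inversions_inj w \<phi>[OF T] by blast
    then show "w \<in> \<phi> ` {T. torsion_class n T}"
      using T by (intro image_eqI[of w \<phi> ?T]) auto
  qed (use \<phi> in auto)
  ultimately have "bij_betw \<phi> {T. torsion_class n T} {w. w permutes {0..n}}" by (simp add: bij_betw_def)
  then show ?thesis
    using lattice_isomorphicI[OF lattice_tors[of n, unfolded tors_def], of \<phi>] le
    unfolding tors_def weak_order_def by simp
qed

theorem theorem4p3p8:
  fixes n :: nat
  assumes "n \<ge> 1"
  shows "(\<forall>(T :: 'k::field rep set) T' M.
            torsion_class n T \<and> torsion_class n T' \<and> minimal_extending n T M
              \<and> T' = Filt n (T \<union> {M})
            \<longrightarrow> inv_tors n T' - inv_tors n T = {inv_mod n M})
       \<and> lattice_isomorphic (tors n :: 'k rep set gorder) (weak_order n)"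
  using inv_tors_minimal_extension lattice_isomorphic_tors_weak_order by blast

end
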